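(* Let $\{K(x,dy),\gamma(dy),m\}$ be a triplet and $M(x,A)=K(x,A)+K(x,E)\,m\,\gamma(A)$. Suppose that $f(R_* )\ge 1/m$, so that there is a unique $R\in(0,\infty)$ satisfying $mf(R)=1$. Then $$u(x)=(1+m)\big(K^{(R)}(x,E)-1\big)1_{\{x\in E_R\}},\qquad \nu(A)=\frac{m}{1+m}\int K^{(R)}(y,A)\,\gamma(dy)$$ are well-defined and satisfy $$\int u(x)\gamma(dx)=\frac{1+m}{m},\qquad \nu(E)=1,\qquad \int u(x)\nu(dx)=mRf'(R).$$ Put $\rho=R^{-1}$. For $x\in E_R$ and $A\in\mathcal E$, $$\int u(y)M(x,dy)=\rho\,u(x),\qquad \int M(y,A)\,\nu(dy)=\rho\,\nu(A).$$ Moreover, for $x\in E_R$ and $A\in\mathcal E$: if $f'(R)<\infty$, then $$R^nM^n(x,A)\to\frac{u(x)\nu(A)}{mRf'(R)},\qquad n\to\infty,$$ and if $f'(R)=\infty$, then $R^nM^n(x,A)\to0$ as $n\to\infty$.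
   Context: $(E,\mathcal E)$ is a measurable space; all integrals are over $E$. A triplet $\{K(x,dy),\gamma(dy),m\}$ consists of a sub-stochastic kernel $K$ on $(E,\mathcal E)$ (so $K(x,E)\le1$), a probability measure $\gamma$ on $(E,\mathcal E)$, and a number $m\in(0,\infty)$. Kernel powers: $M^0(x,A)=1_{\{x\in A\}}$, $M^n(x,A)=\int M^{n-1}(y,A)M(x,dy)$ for $n\ge1$, and $K^n$ is defined similarly from $K$. For $s\ge 0$, $$K^{(s)}(x,A)=\sum_{n=0}^\infty s^nK^n(x,A),\qquad E_s=\{x\in E:K^{(s)}(x,E)<\infty\},$$ $$f(s)=\sum_{n\ge1}d_ns^n,\qquad d_n=\int K^n(x,E)\gamma(dx),\quad n\ge1,$$ and $R_*=\inf\{s>0: f(s)=\infty\}$ is the radius of convergence of $f$ ($R_*=\infty$ is possible, in which case $f(R_* )$ is the limit of $f(s)$ as $s\to\infty$). $f'(R)=\sum_{n\ge1}nd_nR^{n-1}\in[0,\infty]$. *)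

theory Defs
  imports "HOL-Probability.Probability"
begin

text \<open>
  Kernels on a measurable space \<open>E\<close> are functions \<open>K :: 'a \<Rightarrow> 'a measure\<close>, with \<open>K(x, A)\<close> rendered as
  \<open>emeasure (K x) A\<close>; only the values at \<open>x \<in> space E\<close> matter.  Everything that may be infinite
  takes values in \<open>ennreal\<close>.
\<close>

primrec kernel_pow :: "('a \<Rightarrow> 'a measure) \<Rightarrow> nat \<Rightarrow> 'a \<Rightarrow> 'a set \<Rightarrow> ennreal" where
  "kernel_pow K 0 x A = indicator A x"
| "kernel_pow K (Suc n) x A = (\<integral>\<^sup>+ y. kernel_pow K n y A \<partial>K x)"

definition kernel_gen :: "('a \<Rightarrow> 'a measure) \<Rightarrow> real \<Rightarrow> 'a \<Rightarrow> 'a set \<Rightarrow> ennreal" where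
  "kernel_gen K s x A = (\<Sum>n. ennreal s ^ n * kernel_pow K n x A)"

definition finite_pts :: "'a measure \<Rightarrow> ('a \<Rightarrow> 'a measure) \<Rightarrow> real \<Rightarrow> 'a set" where
  "finite_pts E K s = {x \<in> space E. kernel_gen K s x (space E) < \<infinity>}"

definition d_coeff :: "'a measure \<Rightarrow> ('a \<Rightarrow> 'a measure) \<Rightarrow> 'a measure \<Rightarrow> nat \<Rightarrow> ennreal" where
  "d_coeff E K \<gamma> n = (\<integral>\<^sup>+ x. kernel_pow K n x (space E) \<partial>\<gamma>)"

text \<open>The series below run over \<open>n \<ge> 1\<close>, hence the index shift.\<close>

definition f_gen :: "'a measure \<Rightarrow> ('a \<Rightarrow> 'a measure) \<Rightarrow> 'a measure \<Rightarrow> real \<Rightarrow> ennreal" where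
  "f_gen E K \<gamma> s = (\<Sum>n. d_coeff E K \<gamma> (Suc n) * ennreal s ^ Suc n)"

definition f_gen_deriv :: "'a measure \<Rightarrow> ('a \<Rightarrow> 'a measure) \<Rightarrow> 'a measure \<Rightarrow> real \<Rightarrow> ennreal" where
  "f_gen_deriv E K \<gamma> s = (\<Sum>n. of_nat (Suc n) * d_coeff E K \<gamma> (Suc n) * ennreal s ^ n)"

text \<open>The infimum of the empty set in \<open>ennreal\<close> is \<open>\<infinity>\<close>.\<close>

definition R_star :: "'a measure \<Rightarrow> ('a \<Rightarrow> 'a measure) \<Rightarrow> 'a measure \<Rightarrow> ennreal" where
  "R_star E K \<gamma> = (INF s \<in> {s::real. 0 < s \<and> f_gen E K \<gamma> s = \<infinity>}. ennreal s)"

definition f_at_R_star :: "'a measure \<Rightarrow> ('a \<Rightarrow> 'a measure) \<Rightarrow> 'a measure \<Rightarrow> ennreal" where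
  "f_at_R_star E K \<gamma> =
    (if R_star E K \<gamma> = \<infinity> then Lim at_top (f_gen E K \<gamma>) else f_gen E K \<gamma> (enn2real (R_star E K \<gamma>)))"

definition M_kernel :: "'a measure \<Rightarrow> ('a \<Rightarrow> 'a measure) \<Rightarrow> 'a measure \<Rightarrow> real \<Rightarrow> 'a \<Rightarrow> 'a measure" where
  "M_kernel E K \<gamma> m x = measure_of (space E) (sets E)
    (\<lambda>A. emeasure (K x) A + emeasure (K x) (space E) * ennreal m * emeasure \<gamma> A)"

definition u_fun :: "'a measure \<Rightarrow> ('a \<Rightarrow> 'a measure) \<Rightarrow> real \<Rightarrow> real \<Rightarrow> 'a \<Rightarrow> real" where
  "u_fun E K m R x =
    (1 + m) * (enn2real (kernel_gen K R x (space E)) - 1) * indicator (finite_pts E K R) x"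

definition nu_fun :: "('a \<Rightarrow> 'a measure) \<Rightarrow> 'a measure \<Rightarrow> real \<Rightarrow> real \<Rightarrow> 'a set \<Rightarrow> ennreal" where
  "nu_fun K \<gamma> m R A = ennreal (m / (1 + m)) * (\<integral>\<^sup>+ y. kernel_gen K R y A \<partial>\<gamma>)"

definition nu_measure :: "'a measure \<Rightarrow> ('a \<Rightarrow> 'a measure) \<Rightarrow> 'a measure \<Rightarrow> real \<Rightarrow> real \<Rightarrow> 'a measure" where
  "nu_measure E K \<gamma> m R = measure_of (space E) (sets E) (nu_fun K \<gamma> m R)"

text \<open>
  \<^const>\<open>measure_of\<close> yields the zero measure when its argument is not countably additive; this
  does not happen for \<^const>\<open>M_kernel\<close>.
\<close>

lemma sets_M_kernel [simp, measurable_cong]: "sets (M_kernel E K \<gamma> m x) = sets E"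
  by (simp add: M_kernel_def sets.sigma_sets_eq)

lemma space_M_kernel [simp]: "space (M_kernel E K \<gamma> m x) = space E"
  by (simp add: M_kernel_def)

lemma emeasure_M_kernel:
  assumes "sets (K x) = sets E" "sets \<gamma> = sets E" "A \<in> sets E"
  shows "emeasure (M_kernel E K \<gamma> m x) A =
    emeasure (K x) A + emeasure (K x) (space E) * ennreal m * emeasure \<gamma> A"
proof (rule emeasure_measure_of[OF M_kernel_def])
  show "sets E \<subseteq> Pow (space E)"
    by (rule sets.space_closed)
  show "A \<in> sets (M_kernel E K \<gamma> m x)"
    using assms by simp
  show "positive (sets (M_kernel E K \<gamma> m x))
      (\<lambda>A. emeasure (K x) A + emeasure (K x) (space E) * ennreal m * emeasure \<gamma> A)"
    by (simp add: positive_def)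
  show "countably_additive (sets (M_kernel E K \<gamma> m x))
      (\<lambda>A. emeasure (K x) A + emeasure (K x) (space E) * ennreal m * emeasure \<gamma> A)"
  proof (rule countably_additiveI)
    fix F :: "nat \<Rightarrow> 'a set"
    assume F: "range F \<subseteq> sets (M_kernel E K \<gamma> m x)" "disjoint_family F"
    have "(\<Sum>i. emeasure (K x) (F i)) = emeasure (K x) (\<Union>i. F i)"
      "(\<Sum>i. emeasure \<gamma> (F i)) = emeasure \<gamma> (\<Union>i. F i)"
      using F assms by (auto intro!: suminf_emeasure)
    then show "(\<Sum>i. emeasure (K x) (F i) + emeasure (K x) (space E) * ennreal m * emeasure \<gamma> (F i)) =
        emeasure (K x) (\<Union>i. F i) + emeasure (K x) (space E) * ennreal m * emeasure \<gamma> (\<Union>i. F i)"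
      by (simp add: suminf_add[symmetric] ennreal_suminf_cmult)
  qed
qed

end

theory Submission
  imports Defs
begin

text \<open>
  Splitting a path of \<open>M\<close> at its first jump according to \<open>\<gamma>\<close> shows that the numbers
  \<open>R^n \<integral> M^n(x, A) \<gamma>(dx)\<close> solve a renewal equation whose step distribution is \<open>q_j = m R^(j+1) d_(j+1)\<close>;
  it has total mass \<open>m f(R) = 1\<close> and mean \<open>m R f'(R)\<close>. As \<open>K\<close> is sub-stochastic, \<open>d_n\<close> is decreasing,
  and it does not vanish for all \<open>n \<ge> 1\<close>, so \<open>q_0 > 0\<close>. Hence the step distribution is aperiodic and the renewal theorem gives the limit of
  \<open>R^n \<integral> M^n(x, A) \<gamma>(dx)\<close>. A convolution with the summable sequence \<open>R^j K^j(x, E)\<close>, \<open>x \<in> E_R\<close>, then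
  gives the limit of \<open>R^n M^n(x, A)\<close>. For the eigenvalue equations the point is that \<open>E_R\<close> has full
  measure under \<open>\<gamma>\<close>, \<open>\<nu>\<close> and each \<open>K(x, \<cdot>)\<close> with \<open>x \<in> E_R\<close>, so that \<open>u\<close> may be replaced by a power
  series in \<open>K\<close>.
\<close>

section \<open>The discrete renewal theorem\<close>

text \<open>
  Since \<open>w (r i)\<close> is a \<open>q\<close>-average of earlier values, which eventually do not exceed \<open>L\<close> by much,
  and \<open>w (r i - 1)\<close> has the fixed weight \<open>q 0 > 0\<close> in it, this value must be close to \<open>L\<close> as well.
\<close>

lemma renewal_step_back:
  fixes q w :: "nat \<Rightarrow> real"
  assumes q_nonneg: "\<And>j. 0 \<le> q j" and q_sums: "q sums 1" and q0: "0 < q 0"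
    and w_bound: "\<And>n. \<bar>w n\<bar> \<le> 1"
    and w_Suc: "\<And>n. w (Suc n) = (\<Sum>j\<le>n. q j * w (n - j))"
    and upper: "\<And>e. 0 < e \<Longrightarrow> \<forall>\<^sub>F n in sequentially. w n < L + e"
    and r: "filterlim r at_top sequentially" and lim: "(\<lambda>i. w (r i)) \<longlonglongrightarrow> L"
  shows "(\<lambda>i. w (r i - 1)) \<longlonglongrightarrow> L"
proof (rule LIMSEQ_I)
  fix e :: real assume e: "0 < e"
  \<comment> \<open>The final estimate loses \<open>4 * d\<close> and is then divided by
    \<open>q 0\<close>; the bound \<open>d \<le> e\<close> serves the upper estimate of
    \<open>w n\<close>.\<close>
  define d where "d = min e (q 0 * e / 4)"
  have d: "0 < d" "d \<le> e" "4 * d \<le> q 0 * e"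
    using e q0 by (auto simp: d_def min_def)
  obtain N where N: "\<And>n. N \<le> n \<Longrightarrow> w n < L + d"
    using upper[OF d(1)] by (auto simp: eventually_sequentially)
  have "\<forall>\<^sub>F T in sequentially. 1 - d < (\<Sum>j<T. q j)"
    using q_sums d(1) unfolding sums_def by (intro order_tendstoD(1)) auto
  then obtain T where T: "\<And>t. T \<le> t \<Longrightarrow> 1 - d < (\<Sum>j<t. q j)"
    by (auto simp: eventually_sequentially)
  have q_le: "sum q A \<le> 1" if "finite A" for A
    using sum_le_suminf[OF sums_summable[OF q_sums] that] q_nonneg sums_unique[OF q_sums] by auto
  have L_le: "\<bar>L\<bar> \<le> 1"
    using tendsto_le[OF _ tendsto_const tendsto_rabs[OF lim]] w_bound by auto
  have "\<forall>\<^sub>F i in sequentially. N + T + 2 \<le> r i"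
    using r by (auto simp: filterlim_at_top)
  moreover have "\<forall>\<^sub>F i in sequentially. L - d < w (r i)"
    using lim d(1) by (intro order_tendstoD(1)) auto
  ultimately have "\<forall>\<^sub>F i in sequentially. norm (w (r i - 1) - L) < e"
  proof eventually_elim
    case (elim i)
    define n where "n = r i - 1"
    have rn: "r i = Suc n" and n: "N + T + 1 \<le> n" using elim by (auto simp: n_def)
    \<comment> \<open>Three ranges are estimated separately: \<open>j = 0\<close> is the value
      sought, for \<open>1 \<le> j \<le> T\<close> the argument \<open>n - j\<close> is at least
      \<open>N\<close>, and the indices beyond \<open>T\<close> carry mass at most
      \<open>d\<close>.\<close>
    have "w (Suc n) = q 0 * w n + (\<Sum>j\<in>{1..n}. q j * w (n - j))"
      unfolding w_Suc by (simp add: atMost_atLeast0 sum.atLeast_Suc_atMost)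
    also have "{1..n} = {1..T} \<union> {T<..n}" using n by auto
    also have "(\<Sum>j\<in>\<dots>. q j * w (n - j)) = 
      (\<Sum>j\<in>{1..T}. q j * w (n - j)) + (\<Sum>j\<in>{T<..n}. q j * w (n - j))"
      by (rule sum.union_disjoint) auto
    finally have split: "w (Suc n) = q 0 * w n + ((\<Sum>j\<in>{1..T}. q j * w (n - j)) + (\<Sum>j\<in>{T<..n}. q j * w (n - j)))" .
    have "(\<Sum>j\<in>{1..T}. q j * w (n - j)) \<le> (\<Sum>j\<in>{1..T}. q j * (L + d))"
      using n by (intro sum_mono mult_left_mono q_nonneg less_imp_le N) auto
    also have "\<dots> = sum q {1..T} * (L + d)" by (simp add: sum_distrib_right)
    finally have A: "(\<Sum>j\<in>{1..T}. q j * w (n - j)) \<le> sum q {1..T} * (L + d)" .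
    have "(\<Sum>j\<in>{T<..n}. q j * w (n - j)) \<le> (\<Sum>j\<in>{T<..n}. q j * 1)"
      using w_bound by (intro sum_mono mult_left_mono q_nonneg) (auto intro: order_trans[OF abs_ge_self])
    then have B: "(\<Sum>j\<in>{T<..n}. q j * w (n - j)) \<le> sum q {T<..n}" by simp
    have eqs: "sum q {..<Suc T} = q 0 + sum q {1..T}"
      by (simp add: lessThan_Suc_atMost atMost_atLeast0 sum.atLeast_Suc_atMost)
    have "sum q {..<Suc T} + sum q {T<..n} = sum q ({..<Suc T} \<union> {T<..n})"
      by (rule sum.union_disjoint[symmetric]) auto
    then have C: "sum q {T<..n} \<le> d" using q_le[of "{..<Suc T} \<union> {T<..n}"] T[of "Suc T"] by auto
    have s: "1 - d - q 0 \<le> sum q {1..T}" "sum q {1..T} \<le> 1 - q 0"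
      using T[of "Suc T"] q_le[of "{..<Suc T}"] eqs by auto
    \<comment> \<open>\<open>L + d\<close> may be negative. Since \<open>- (L + d) \<le> 1\<close>
      and the missing mass is at most \<open>d\<close>, replacing \<open>sum q {1..T}\<close> by
      \<open>1 - q 0\<close> costs at most \<open>d\<close>.\<close>
    have "(1 - q 0 - sum q {1..T}) * (- (L + d)) \<le> (1 - q 0 - sum q {1..T}) * 1"
      using s L_le d by (intro mult_left_mono) auto
    then have D: "sum q {1..T} * (L + d) \<le> (1 - q 0) * (L + d) + d"
      using s by (simp add: algebra_simps)
    have "L - d < q 0 * w n + ((1 - q 0) * (L + d) + d + d)"
      using elim(2) split A B C D unfolding rn by linarith
    then have "q 0 * (L - e) < q 0 * w n"
      using d mult_pos_pos[OF q0 d(1)] by (simp add: algebra_simps)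
    then have "L - e < w n" using q0 by simp
    moreover have "w n < L + e" using N[of n] n d by simp
    ultimately show ?case by (simp add: n_def abs_less_iff)
  qed
  then show "\<exists>no. \<forall>i\<ge>no. norm (w (r i - 1) - L) < e"
    by (auto simp: eventually_sequentially)
qed

text \<open>Take \<open>L\<close> to be the limsup and \<open>r\<close> a subsequence attaining it;
  \<open>renewal_step_back\<close> then carries the limit from shift \<open>k\<close> to shift
  \<open>k + 1\<close>. The last property records that \<open>L\<close> bounds the sequence
  asymptotically.\<close>

lemma renewal_shifts:
  fixes q w :: "nat \<Rightarrow> real"
  assumes "\<And>j. 0 \<le> q j" "q sums 1" "0 < q 0" "\<And>n. \<bar>w n\<bar> \<le> 1"
    and "\<And>n. w (Suc n) = (\<Sum>j\<le>n. q j * w (n - j))"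
  obtains r L where "filterlim r at_top sequentially" "\<And>k. (\<lambda>i. w (r i - k)) \<longlonglongrightarrow> L"
    "\<And>e. 0 < e \<Longrightarrow> \<forall>\<^sub>F n in sequentially. w n < L + e"
proof -
  obtain r where r: "strict_mono r" "((\<lambda>n. ereal (w n)) \<circ> r) \<longlonglongrightarrow> limsup (\<lambda>n. ereal (w n))"
    using limsup_subseq_lim by blast
  have "limsup (\<lambda>n. ereal (w n)) \<le> ereal 1" "ereal (-1) \<le> limsup (\<lambda>n. ereal (w n))"
    using assms(4) by (auto intro!: Limsup_bounded le_Limsup simp: abs_le_iff minus_le_iff)
  then obtain L where L: "limsup (\<lambda>n. ereal (w n)) = ereal L"
    by (cases "limsup (\<lambda>n. ereal (w n))") auto
  have r_top: "filterlim r at_top sequentially"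
    using r(1) by (rule filterlim_subseq)
  have upper: "\<forall>\<^sub>F n in sequentially. w n < L + e" if "0 < e" for e
    using Limsup_lessD[of sequentially "\<lambda>n. ereal (w n)" "ereal (L + e)"] L that by simp
  have "(\<lambda>i. w (r i - k)) \<longlonglongrightarrow> L" for k
  proof (induction k)
    case 0
    then show ?case using r(2) unfolding L by (simp add: o_def)
  next
    case (Suc k)
    have "filterlim (\<lambda>i. r i - k) at_top sequentially"
      using filterlim_compose[OF filterlim_minus_const_nat_at_top r_top] by simp
    from renewal_step_back[OF assms upper this Suc] show ?case by simp
  qed
  then show ?thesis using that r_top upper by blast
qed

section \<open>Limits of convolutions with a summable sequence\<close>

lemma tendsto_convolution_along:
  fixes a v :: "nat \<Rightarrow> real"
  assumes r: "filterlim r at_top sequentially" and v: "\<And>k. (\<lambda>i. v (r i - k)) \<longlonglongrightarrow> c"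
    and a: "summable (\<lambda>k. \<bar>a k\<bar>)" and B: "\<And>n. \<bar>v n\<bar> \<le> B"
  shows "(\<lambda>i. \<Sum>k\<le>r i. a k * v (r i - k)) \<longlonglongrightarrow> suminf a * c"
proof -
  \<comment> \<open>Padding with zeros turns the finite sums into series over a fixed index set,
    dominated by \<open>\<bar>a k\<bar> * B\<close>, so that Tannery's theorem applies.\<close>
  let ?t = "\<lambda>k i. if k \<le> r i then a k * v (r i - k) else 0"
  have "(\<lambda>i. \<Sum>k. ?t k i) \<longlonglongrightarrow> (\<Sum>k. a k * c)"
  proof (rule tannerys_theorem[THEN conjunct2, THEN conjunct2])
    show "?t k \<longlonglongrightarrow> a k * c" for k
    proof -
      have "\<forall>\<^sub>F i in sequentially. k \<le> r i"
        using r by (auto simp: filterlim_at_top)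
      then have "\<forall>\<^sub>F i in sequentially. a k * v (r i - k) = ?t k i"
        by eventually_elim simp
      then show ?thesis
        by (rule Lim_transform_eventually[rotated]) (intro tendsto_intros v)
    qed
    have "norm (?t k i) \<le> \<bar>a k\<bar> * B" for k i
      using B[of 0] by (auto simp: abs_mult intro!: mult_left_mono B)
    then show "\<forall>\<^sub>F (k, i) in sequentially \<times>\<^sub>F sequentially. norm (?t k i) \<le> \<bar>a k\<bar> * B"
      by (intro always_eventually) auto
    show "summable (\<lambda>k. \<bar>a k\<bar> * B)" using a by (rule summable_mult2)
  qed simp
  moreover have "(\<Sum>k. ?t k i) = (\<Sum>k\<le>r i. a k * v (r i - k))" for i
    by (subst suminf_finite[of "{..r i}"]) auto
  moreover have "(\<Sum>k. a k * c) = suminf a * c"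
    using summable_rabs_cancel[OF a] by (rule suminf_mult2[symmetric])
  ultimately show ?thesis by simp
qed

lemma tendsto_convolution:
  fixes a v :: "nat \<Rightarrow> real"
  assumes "v \<longlonglongrightarrow> c" and "summable (\<lambda>k. \<bar>a k\<bar>)"
  shows "(\<lambda>n. \<Sum>k\<le>n. a k * v (n - k)) \<longlonglongrightarrow> suminf a * c"
proof -
  have "convergent v" using assms(1) by (auto simp: convergent_def)
  then obtain B where "\<And>n. \<bar>v n\<bar> \<le> B"
    using convergent_imp_Bseq[of v] by (auto simp: Bseq_def)
  moreover have "(\<lambda>i. v (i - k)) \<longlonglongrightarrow> c" for k
    using filterlim_compose[OF assms(1) filterlim_minus_const_nat_at_top] .
  ultimately show ?thesis
    using assms(2) by (intro tendsto_convolution_along[where r = "\<lambda>i. i"]) (auto simp: filterlim_ident)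
qed

section \<open>The renewal sequence and its limit\<close>

fun renewal_seq :: "(nat \<Rightarrow> real) \<Rightarrow> nat \<Rightarrow> real" where
  "renewal_seq q 0 = 1"
| "renewal_seq q (Suc n) = (\<Sum>j\<le>n. q j * renewal_seq q (n - j))"

text \<open>For a probability distribution \<open>q\<close>, with \<open>q j\<close> the probability
  of a step of length \<open>j + 1\<close>, \<open>renewal_seq q n\<close> is the probability of a
  renewal at time \<open>n\<close>. The summand with index \<open>k\<close> is then the probability
  that the last renewal up to time \<open>n\<close> is at \<open>n - k\<close>, and these events
  form a partition.\<close>

lemma renewal_seq_tails:
  "(\<Sum>k\<le>n. (1 - (\<Sum>j<k. q j)) * renewal_seq q (n - k)) = 1"
proof (induction n)
  case (Suc n)
  have "(\<Sum>k\<le>Suc n. (1 - (\<Sum>j<k. q j)) * renewal_seq q (Suc n - k)) =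
    renewal_seq q (Suc n) + (\<Sum>k\<le>n. (1 - (\<Sum>j<Suc k. q j)) * renewal_seq q (n - k))"
    by (subst sum.atMost_Suc_shift) simp
  also have "(\<Sum>k\<le>n. (1 - (\<Sum>j<Suc k. q j)) * renewal_seq q (n - k)) = 1 - renewal_seq q (Suc n)"
    using Suc by (simp add: algebra_simps sum_subtractf sum.distrib)
  finally show ?case by simp
qed simp

lemma renewal_seq_nonneg: "(\<And>j. 0 \<le> q j) \<Longrightarrow> 0 \<le> renewal_seq q n"
  by (induction q n rule: renewal_seq.induct) (auto intro!: sum_nonneg mult_nonneg_nonneg)

text \<open>
  Along a sequence of indices realizing the limsup all shifts have the same limit \<open>L\<close>, so
  \<open>renewal_seq_tails\<close> forces \<open>L * (\<Sum>k. t k) = 1\<close>. For a finite mean the same applied to the negated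
  sequence identifies the liminf.
\<close>

lemma renewal_seq_tendsto:
  fixes q :: "nat \<Rightarrow> real"
  assumes q_nonneg: "\<And>j. 0 \<le> q j" and q_sums: "q sums 1" and q0: "0 < q 0"
  defines "t \<equiv> \<lambda>k. 1 - (\<Sum>j<k. q j)"
  shows "renewal_seq q \<longlonglongrightarrow> (if summable t then 1 / suminf t else 0)"
proof -
  let ?v = "renewal_seq q"
  have t_nonneg: "0 \<le> t k" for k
    using sum_le_suminf[OF sums_summable[OF q_sums], of "{..<k}"] q_nonneg sums_unique[OF q_sums]
    by (auto simp: t_def)
  have v_nonneg: "0 \<le> ?v n" for n using q_nonneg by (rule renewal_seq_nonneg)
  have tails: "(\<Sum>k\<le>n. t k * ?v (n - k)) = 1" for n
    unfolding t_def by (rule renewal_seq_tails)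
  \<comment> \<open>In the tail identity all terms are nonnegative, and the one with
    \<open>k = 0\<close> is \<open>?v n\<close> because \<open>t 0 = 1\<close>.\<close>
  have v_le: "?v n \<le> 1" for n
    using member_le_sum[of 0 "{..n}" "\<lambda>k. t k * ?v (n - k)"] tails[of n] t_nonneg v_nonneg
    by (simp add: t_def)
  have v_abs: "\<bar>?v n\<bar> \<le> 1" for n using v_nonneg v_le by simp
  obtain r L where rL: "filterlim r at_top sequentially" "\<And>k. (\<lambda>i. ?v (r i - k)) \<longlonglongrightarrow> L"
    "\<And>e. 0 < e \<Longrightarrow> \<forall>\<^sub>F n in sequentially. ?v n < L + e"
    using renewal_shifts[OF q_nonneg q_sums q0 v_abs renewal_seq.simps(2)] by metis
  show ?thesis
  proof (cases "summable t")
    case True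
    \<comment> \<open>By the tail identity the convolution of \<open>t\<close> with
      \<open>?v\<close> is constantly 1, so its limit along \<open>s\<close> is 1. This is applied
      to \<open>L\<close> and to \<open>- L'\<close>.\<close>
    have mean: "suminf t * c = 1" if "filterlim s at_top sequentially" "\<And>k. (\<lambda>i. ?v (s i - k)) \<longlonglongrightarrow> c" for s c
      using tendsto_convolution_along[OF that _ v_abs, of t] True t_nonneg tails
      by (simp add: LIMSEQ_const_iff)
    have "\<bar>- ?v n\<bar> \<le> 1" "- ?v (Suc n) = (\<Sum>j\<le>n. q j * - ?v (n - j))" for n
      using v_abs by (auto simp: sum_negf)
    then obtain s L' where sL: "filterlim s at_top sequentially" "\<And>k. (\<lambda>i. - ?v (s i - k)) \<longlonglongrightarrow> L'"
      "\<And>e. 0 < e \<Longrightarrow> \<forall>\<^sub>F n in sequentially. - ?v n < L' + e"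
      using renewal_shifts[OF q_nonneg q_sums q0, of "\<lambda>n. - ?v n"] by metis
    have L: "L = 1 / suminf t" using mean[OF rL(1,2)] by (auto simp: divide_simps mult.commute)
    have "suminf t * - L' = 1" using mean[OF sL(1), of "- L'"] tendsto_minus[OF sL(2)] by simp
    then have L': "L' = - (1 / suminf t)" by (auto simp: divide_simps mult.commute)
    have "?v \<longlonglongrightarrow> 1 / suminf t"
    proof (rule LIMSEQ_I)
      fix e :: real assume "0 < e"
      from rL(3)[OF this] sL(3)[OF this]
      have "\<forall>\<^sub>F n in sequentially. norm (?v n - 1 / suminf t) < e"
        unfolding L L' by eventually_elim (simp add: abs_less_iff)
      then show "\<exists>no. \<forall>n\<ge>no. norm (?v n - 1 / suminf t) < e"
        by (simp add: eventually_sequentially)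
    qed
    with True show ?thesis by simp
  next
    case False
    have L_nonneg: "0 \<le> L" using tendsto_lowerbound[OF rL(2)[of 0]] v_nonneg by auto
    \<comment> \<open>Truncating the tail identity at \<open>N\<close> leaves at most 1, also in the
      limit along \<open>r\<close>. If \<open>L\<close> were positive, the partial sums of
      \<open>t\<close> would be bounded by \<open>1 / L\<close> and \<open>t\<close> would be
      summable.\<close>
    have "(\<Sum>k<N. t k) * L \<le> 1" for N
    proof (rule tendsto_upperbound)
      show "(\<lambda>i. \<Sum>k<N. t k * ?v (r i - k)) \<longlonglongrightarrow> (\<Sum>k<N. t k) * L"
        unfolding sum_distrib_right by (intro tendsto_intros rL(2))
      have "\<forall>\<^sub>F i in sequentially. N \<le> r i"
        using rL(1) by (auto simp: filterlim_at_top)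
      then show "\<forall>\<^sub>F i in sequentially. (\<Sum>k<N. t k * ?v (r i - k)) \<le> 1"
      proof eventually_elim
        case (elim i)
        have "(\<Sum>k<N. t k * ?v (r i - k)) \<le> (\<Sum>k\<le>r i. t k * ?v (r i - k))"
          using elim t_nonneg v_nonneg by (intro sum_mono2) auto
        then show ?case using tails by simp
      qed
    qed simp
    then have "(\<Sum>k<N. t k) \<le> 1 / L" if "0 < L" for N
      using that by (simp add: divide_simps)
    then have "L = 0"
      using False summableI_nonneg_bounded[of t "1 / L"] t_nonneg L_nonneg by (cases "0 < L") auto
    then have "?v \<longlonglongrightarrow> 0"
      using rL(3) v_nonneg by (auto intro!: order_tendstoI intro: always_eventually less_le_trans)
    with False show ?thesis by simp
  qed
qed

section \<open>Renewal equations with a general inhomogeneity\<close>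

lemma renewal_equation_solution:
  fixes G b q :: "nat \<Rightarrow> real"
  assumes "G 0 = b 0" "\<And>n. G (Suc n) = b (Suc n) + (\<Sum>j\<le>n. q j * G (n - j))"
  shows "G n = (\<Sum>k\<le>n. b k * renewal_seq q (n - k))"
proof (induction n rule: less_induct)
  case (less n)
  show ?case
  proof (cases n)
    case (Suc l)
    have "(\<Sum>j\<le>l. q j * G (l - j)) = (\<Sum>j\<le>l. \<Sum>k\<le>l - j. b k * (q j * renewal_seq q (l - j - k)))"
      by (intro sum.cong refl) (simp add: less Suc less_Suc_eq_le sum_distrib_left mult_ac)
    \<comment> \<open>Both double sums run over the pairs with \<open>j + k \<le> l\<close>;
      afterwards the inner sum is the recursion of \<open>renewal_seq\<close>.\<close>
    also have "\<dots> = (\<Sum>k\<le>l. \<Sum>j\<le>l - k. b k * (q j * renewal_seq q (l - j - k)))"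
      unfolding sum.Sigma[OF finite_atMost ballI[OF finite_atMost]]
      by (rule sum.reindex_bij_witness[of _ prod.swap prod.swap]) auto
    also have "\<dots> = (\<Sum>k\<le>l. b k * renewal_seq q (Suc l - k))"
      by (intro sum.cong refl) (simp add: Suc_diff_le sum_distrib_left diff_commute diff_diff_eq add.commute)
    finally show ?thesis using assms(2)[of l] Suc by simp
  qed (simp add: assms)
qed

lemma renewal_equation_tendsto:
  fixes G b q :: "nat \<Rightarrow> real"
  assumes "\<And>j. 0 \<le> q j" and "q sums 1" and "0 < q 0" and "summable (\<lambda>k. \<bar>b k\<bar>)"
    and "G 0 = b 0" and "\<And>n. G (Suc n) = b (Suc n) + (\<Sum>j\<le>n. q j * G (n - j))"
  defines "t \<equiv> \<lambda>k. 1 - (\<Sum>j<k. q j)"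
  shows "G \<longlonglongrightarrow> (if summable t then suminf b / suminf t else 0)"
proof -
  have "G = (\<lambda>n. \<Sum>k\<le>n. b k * renewal_seq q (n - k))"
    using renewal_equation_solution[of G b q, OF assms(5,6)] by (intro ext)
  then show ?thesis
    using tendsto_convolution[OF renewal_seq_tendsto[OF assms(1-3)] assms(4)]
    unfolding t_def by (auto split: if_splits)
qed

section \<open>Iterated kernels\<close>

lemma suminf_suminf_swap:
  fixes f :: "nat \<Rightarrow> nat \<Rightarrow> ennreal"
  shows "(\<Sum>i. \<Sum>j. f i j) = (\<Sum>j. \<Sum>i. f i j)"
proof -
  have "(\<Sum>i. \<Sum>j. f i j) = (\<Sum>i. \<integral>\<^sup>+ j. f i j \<partial>count_space UNIV)"
    by (simp add: nn_integral_count_space_nat)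
  also have "\<dots> = (\<integral>\<^sup>+ j. (\<Sum>i. f i j) \<partial>count_space UNIV)"
    by (rule nn_integral_suminf[symmetric]) simp
  also have "\<dots> = (\<Sum>j. \<Sum>i. f i j)"
    by (rule nn_integral_count_space_nat)
  finally show ?thesis .
qed

text \<open>There are \<open>N + 1\<close> pairs \<open>(n, j)\<close> with
  \<open>n + j = N\<close>. This produces the factor \<open>n\<close> in the series for
  \<open>f'\<close>, once for the integral of \<open>u\<close> and once for the mean of the step
  distribution.\<close>

lemma suminf_suminf_shift:
  fixes a :: "nat \<Rightarrow> ennreal"
  shows "(\<Sum>n. \<Sum>j. a (n + j)) = (\<Sum>N. of_nat (Suc N) * a N)"
proof -
  let ?g = "\<lambda>n N. if n \<le> N then a N else 0"
  have "(\<Sum>j. a (n + j)) = (\<Sum>N. ?g n N)" for n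
    using suminf_offset[of "?g n" n] by (simp add: add.commute)
  then have "(\<Sum>n. \<Sum>j. a (n + j)) = (\<Sum>N. \<Sum>n. ?g n N)"
    by (simp add: suminf_suminf_swap[of ?g])
  also have "(\<lambda>N. \<Sum>n. ?g n N) = (\<lambda>N. of_nat (Suc N) * a N)"
  proof
    fix N show "(\<Sum>n. ?g n N) = of_nat (Suc N) * a N"
      by (subst suminf_finite[of "{..N}"]) auto
  qed
  finally show ?thesis .
qed

text \<open>Induction over measurable functions: indicators, linearity, monotone limits. It yields
  integral formulas for \<open>M x\<close> and \<open>\<nu>\<close>, which are built by
  \<open>measure_of\<close> from their values on sets.\<close>

lemma nn_integral_eq_functional:
  fixes \<Phi> :: "('a \<Rightarrow> ennreal) \<Rightarrow> ennreal"
  assumes sets_N: "sets N = sets E"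
    and indicator: "\<And>A. A \<in> sets E \<Longrightarrow> emeasure N A = \<Phi> (indicator A)"
    and cong: "\<And>f g. (\<And>x. x \<in> space E \<Longrightarrow> f x = g x) \<Longrightarrow> \<Phi> f = \<Phi> g"
    and cmult: "\<And>f c. f \<in> borel_measurable E \<Longrightarrow> \<Phi> (\<lambda>x. c * f x) = c * \<Phi> f"
    and add: "\<And>f g. f \<in> borel_measurable E \<Longrightarrow> g \<in> borel_measurable E \<Longrightarrow> \<Phi> (\<lambda>x. f x + g x) = \<Phi> f + \<Phi> g"
    and SUP: "\<And>f. (\<And>i. f i \<in> borel_measurable E) \<Longrightarrow> incseq f \<Longrightarrow> \<Phi> (\<lambda>x. SUP i. f i x) = (SUP i. \<Phi> (f i))"
    and h: "h \<in> borel_measurable E"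
  shows "(\<integral>\<^sup>+ x. h x \<partial>N) = \<Phi> h"
  using h
proof (induction rule: borel_measurable_induct)
  case (cong f g)
  then have "(\<integral>\<^sup>+ x. f x \<partial>N) = (\<integral>\<^sup>+ x. g x \<partial>N)"
    by (intro nn_integral_cong) (simp add: sets_eq_imp_space_eq[OF sets_N])
  with cong assms(3)[of f g] show ?case by simp
next
  case (set A)
  then show ?case by (simp add: indicator sets_N)
next
  case (mult h c)
  then show ?case by (simp add: cmult nn_integral_cmult measurable_cong_sets[OF sets_N refl])
next
  case (add h k)
  then show ?case by (simp add: assms(5) nn_integral_add measurable_cong_sets[OF sets_N refl])
next
  case (seq U)
  then have "(SUP i. U i) = (\<lambda>x. SUP i. U i x)" by (auto simp: fun_eq_iff image_comp)
  with seq show ?case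
    by (simp add: SUP nn_integral_monotone_convergence_SUP measurable_cong_sets[OF sets_N refl])
qed

text \<open>The operator \<open>K^n\<close> on functions. Unlike the powers on sets, it can be
  composed with itself, which gives \<open>K^n K^j = K^(n + j)\<close>.\<close>

primrec kernel_iter :: "('a \<Rightarrow> 'a measure) \<Rightarrow> nat \<Rightarrow> ('a \<Rightarrow> ennreal) \<Rightarrow> 'a \<Rightarrow> ennreal" where
  "kernel_iter K 0 h x = h x"
| "kernel_iter K (Suc n) h x = (\<integral>\<^sup>+ y. kernel_iter K n h y \<partial>K x)"

lemma kernel_pow_eq_iter: "kernel_pow K n x A = kernel_iter K n (indicator A) x"
  by (induction n arbitrary: x) auto

lemma kernel_pow_empty [simp]: "kernel_pow K n x {} = 0"
  by (induction n arbitrary: x) auto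

lemma kernel_iter_iter: "kernel_iter K n (kernel_iter K j h) x = kernel_iter K (n + j) h x"
  by (induction n arbitrary: x) auto

section \<open>Iterates of a sub-stochastic kernel on nonnegative functions\<close>

locale subprob_kernel =
  fixes E :: "'a measure" and K :: "'a \<Rightarrow> 'a measure"
  assumes kernel: "K \<in> measurable E (subprob_algebra E)"
begin

lemma sets_kernel: "x \<in> space E \<Longrightarrow> sets (K x) = sets E"
  using measurable_space[OF kernel] by (simp add: space_subprob_algebra)

lemma space_kernel: "x \<in> space E \<Longrightarrow> space (K x) = space E"
  using sets_eq_imp_space_eq[OF sets_kernel] .

lemma borel_measurable_kernel: "x \<in> space E \<Longrightarrow> borel_measurable (K x) = borel_measurable E"
  using sets_kernel by (intro measurable_cong_sets) auto

lemma emeasure_kernel_le_1: "x \<in> space E \<Longrightarrow> emeasure (K x) A \<le> 1"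
  using measurable_space[OF kernel] by (simp add: space_subprob_algebra subprob_space.subprob_emeasure_le_1)

lemma nn_integral_kernel_measurable:
  "h \<in> borel_measurable E \<Longrightarrow> (\<lambda>x. \<integral>\<^sup>+ y. h y \<partial>K x) \<in> borel_measurable E"
  using measurable_compose[OF kernel nn_integral_measurable_subprob_algebra] .

lemma kernel_iter_measurable [measurable]:
  "h \<in> borel_measurable E \<Longrightarrow> kernel_iter K n h \<in> borel_measurable E"
  by (induction n) (auto intro: nn_integral_kernel_measurable simp: fun_eq_iff cong: measurable_cong)

lemma kernel_pow_measurable [measurable]:
  "A \<in> sets E \<Longrightarrow> (\<lambda>x. kernel_pow K n x A) \<in> borel_measurable E"
  unfolding kernel_pow_eq_iter by (intro kernel_iter_measurable) simp

lemma kernel_iter_cong: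
  "(\<And>y. y \<in> space E \<Longrightarrow> h y = g y) \<Longrightarrow> x \<in> space E \<Longrightarrow> kernel_iter K n h x = kernel_iter K n g x"
  by (induction n arbitrary: x) (auto intro!: nn_integral_cong simp: space_kernel)

lemma kernel_iter_mono:
  "(\<And>y. y \<in> space E \<Longrightarrow> h y \<le> g y) \<Longrightarrow> x \<in> space E \<Longrightarrow> kernel_iter K n h x \<le> kernel_iter K n g x"
  by (induction n arbitrary: x) (auto intro!: nn_integral_mono simp: space_kernel)

lemma kernel_iter_cmult:
  assumes "h \<in> borel_measurable E" "x \<in> space E"
  shows "kernel_iter K n (\<lambda>y. c * h y) x = c * kernel_iter K n h x"
  using assms(2)
proof (induction n arbitrary: x)
  case (Suc n)
  have "kernel_iter K (Suc n) (\<lambda>y. c * h y) x = (\<integral>\<^sup>+ y. c * kernel_iter K n h y \<partial>K x)"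
    unfolding kernel_iter.simps by (intro nn_integral_cong Suc.IH) (simp add: space_kernel Suc.prems)
  with assms(1) show ?case
    by (simp add: nn_integral_cmult borel_measurable_kernel Suc.prems)
qed simp

lemma kernel_iter_add:
  assumes "h \<in> borel_measurable E" "g \<in> borel_measurable E" "x \<in> space E"
  shows "kernel_iter K n (\<lambda>y. h y + g y) x = kernel_iter K n h x + kernel_iter K n g x"
  using assms(3)
proof (induction n arbitrary: x)
  case (Suc n)
  have "kernel_iter K (Suc n) (\<lambda>y. h y + g y) x = (\<integral>\<^sup>+ y. kernel_iter K n h y + kernel_iter K n g y \<partial>K x)"
    unfolding kernel_iter.simps by (intro nn_integral_cong Suc.IH) (simp add: space_kernel Suc.prems)
  with assms show ?case
    by (simp add: nn_integral_add borel_measurable_kernel Suc.prems)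
qed simp

lemma kernel_iter_suminf:
  assumes "\<And>i. h i \<in> borel_measurable E" "x \<in> space E"
  shows "kernel_iter K n (\<lambda>y. \<Sum>i. h i y) x = (\<Sum>i. kernel_iter K n (h i) x)"
  using assms(2)
proof (induction n arbitrary: x)
  case (Suc n)
  have "kernel_iter K (Suc n) (\<lambda>y. \<Sum>i. h i y) x = (\<integral>\<^sup>+ y. (\<Sum>i. kernel_iter K n (h i) y) \<partial>K x)"
    unfolding kernel_iter.simps by (intro nn_integral_cong Suc.IH) (simp add: space_kernel Suc.prems)
  with assms show ?case
    by (simp add: nn_integral_suminf borel_measurable_kernel Suc.prems)
qed simp

lemma incseq_kernel_iter:
  assumes "incseq h" "x \<in> space E"
  shows "incseq (\<lambda>i. kernel_iter K n (h i) x)"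
  using assms by (auto simp: incseq_def le_fun_def intro: kernel_iter_mono)

lemma kernel_iter_SUP:
  assumes "\<And>i. h i \<in> borel_measurable E" "incseq h" "x \<in> space E"
  shows "kernel_iter K n (\<lambda>y. SUP i. h i y) x = (SUP i. kernel_iter K n (h i) x)"
  using assms(3)
proof (induction n arbitrary: x)
  case (Suc n)
  have "kernel_iter K (Suc n) (\<lambda>y. SUP i. h i y) x = (\<integral>\<^sup>+ y. (SUP i. kernel_iter K n (h i) y) \<partial>K x)"
    unfolding kernel_iter.simps by (intro nn_integral_cong Suc.IH) (simp add: space_kernel Suc.prems)
  also have "\<dots> = (SUP i. \<integral>\<^sup>+ y. kernel_iter K n (h i) y \<partial>K x)"
  \<comment> \<open>\<open>incseq_kernel_iter\<close> gives monotonicity at the points of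
    \<open>space E\<close>, hence the almost everywhere form of monotone convergence.\<close>
  proof (rule nn_integral_monotone_convergence_SUP_AE)
    show "AE y in K x. kernel_iter K n (h i) y \<le> kernel_iter K n (h (Suc i)) y" for i
      using incseq_kernel_iter[OF assms(2), THEN incseq_SucD] by (intro AE_I2) (simp add: space_kernel Suc.prems)
  qed (simp add: borel_measurable_kernel Suc.prems assms(1) kernel_iter_measurable)
  finally show ?case by simp
qed simp

text \<open>Sub-stochasticity means \<open>K 1 \<le> 1\<close>; applying the monotone operator
  \<open>K^i\<close> to both sides gives the step from \<open>i\<close> to
  \<open>i + 1\<close>.\<close>

lemma kernel_pow_space_decreasing:
  assumes "x \<in> space E" "i \<le> j"
  shows "kernel_pow K j x (space E) \<le> kernel_pow K i x (space E)"
proof -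
  have "kernel_iter K (i + Suc 0) (indicator (space E)) x \<le> kernel_iter K i (indicator (space E)) x"
    if "x \<in> space E" for i x
    unfolding kernel_iter_iter[symmetric] using that
    by (intro kernel_iter_mono) (auto simp: sets_kernel emeasure_kernel_le_1)
  then have "decseq (\<lambda>i. kernel_pow K i x (space E))"
    using assms(1) by (simp add: decseq_Suc_iff kernel_pow_eq_iter)
  then show ?thesis using assms(2) by (rule decseqD)
qed

lemma kernel_pow_mono:
  "A \<subseteq> B \<Longrightarrow> x \<in> space E \<Longrightarrow> kernel_pow K n x A \<le> kernel_pow K n x B"
  unfolding kernel_pow_eq_iter by (intro kernel_iter_mono) (auto split: split_indicator)

lemma kernel_pow_le_1:
  assumes "x \<in> space E" shows "kernel_pow K n x A \<le> 1"
proof -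
  have "kernel_pow K n x A \<le> kernel_iter K n (indicator (space E)) x"
    unfolding kernel_pow_eq_iter using assms by (intro kernel_iter_mono) (auto split: split_indicator)
  also have "\<dots> \<le> 1"
    using kernel_pow_space_decreasing[OF assms, of 0 n] assms by (simp add: kernel_pow_eq_iter)
  finally show ?thesis .
qed

end

section \<open>The perturbed kernel\<close>

locale rank_one_perturbation = subprob_kernel E K for E :: "'a measure" and K +
  fixes \<gamma> :: "'a measure" and m :: real
  assumes prob_\<gamma>: "prob_space \<gamma>" and sets_\<gamma>: "sets \<gamma> = sets E" and m_pos: "0 < m"
begin

abbreviation "M \<equiv> M_kernel E K \<gamma> m"
abbreviation "d \<equiv> d_coeff E K \<gamma>"

lemma space_\<gamma>: "space \<gamma> = space E"
  using sets_eq_imp_space_eq[OF sets_\<gamma>] .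

lemma borel_measurable_\<gamma>: "borel_measurable \<gamma> = borel_measurable E"
  using sets_\<gamma> by (intro measurable_cong_sets) auto

lemma emeasure_\<gamma>_space: "emeasure \<gamma> (space E) = 1"
  using prob_space.emeasure_space_1[OF prob_\<gamma>] by (simp add: space_\<gamma>)

lemma nn_integral_M_kernel:
  assumes x: "x \<in> space E" and h: "h \<in> borel_measurable E"
  shows "(\<integral>\<^sup>+ y. h y \<partial>M x) =
    (\<integral>\<^sup>+ y. h y \<partial>K x) + emeasure (K x) (space E) * ennreal m * (\<integral>\<^sup>+ y. h y \<partial>\<gamma>)"
proof (rule nn_integral_eq_functional[where N = "M x" and E = E])
  let ?c = "emeasure (K x) (space E) * ennreal m"
  let ?\<Phi> = "\<lambda>h. (\<integral>\<^sup>+ y. h y \<partial>K x) + ?c * (\<integral>\<^sup>+ y. h y \<partial>\<gamma>)"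
  note [simp] = borel_measurable_kernel[OF x] borel_measurable_\<gamma> sets_kernel[OF x] sets_\<gamma>
  show "emeasure (M x) A = ?\<Phi> (indicator A)" if "A \<in> sets E" for A
    using that by (simp add: emeasure_M_kernel)
  show "?\<Phi> f = ?\<Phi> g" if "\<And>x. x \<in> space E \<Longrightarrow> f x = g x" for f g
    using that by (intro arg_cong2[where f = "\<lambda>a b. a + ?c * b"] nn_integral_cong)
      (auto simp: space_kernel[OF x] space_\<gamma>)
  show "?\<Phi> (\<lambda>x. c * f x) = c * ?\<Phi> f" if "f \<in> borel_measurable E" for f c
    using that by (simp add: nn_integral_cmult distrib_left mult_ac)
  show "?\<Phi> (\<lambda>x. f x + g x) = ?\<Phi> f + ?\<Phi> g"
    if "f \<in> borel_measurable E" "g \<in> borel_measurable E" for f g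
    using that by (simp add: nn_integral_add distrib_left add_ac)
  show "?\<Phi> (\<lambda>x. SUP i. f i x) = (SUP i. ?\<Phi> (f i))"
    if f: "\<And>i. f i \<in> borel_measurable E" "incseq f" for f :: "nat \<Rightarrow> _"
  proof -
    have mono: "incseq (\<lambda>i. \<integral>\<^sup>+ y. f i y \<partial>N)" for N
      using f(2) by (auto simp: incseq_def le_fun_def intro: nn_integral_mono)
    show ?thesis
      using f mono
      by (simp add: nn_integral_monotone_convergence_SUP SUP_mult_left_ennreal
          ennreal_SUP_add[symmetric] incseq_def mult_left_mono)
  qed
qed (simp_all add: h)

text \<open>The mass of \<open>M x\<close> may exceed 1, so measurability is read off from the
  integral formula and not from \<open>subprob_algebra\<close>.\<close>

lemma nn_integral_M_measurable:
  assumes [measurable]: "h \<in> borel_measurable E"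
  shows "(\<lambda>x. \<integral>\<^sup>+ y. h y \<partial>M x) \<in> borel_measurable E"
proof (subst measurable_cong[OF nn_integral_M_kernel])
  note [measurable] = nn_integral_kernel_measurable[OF assms]
  have "(\<lambda>x. emeasure (K x) (space E)) \<in> borel_measurable E"
    using kernel_pow_measurable[OF sets.top, of 1]
    by (subst measurable_cong[where g = "\<lambda>x. kernel_pow K 1 x (space E)"]) (auto simp: sets_kernel)
  then show "(\<lambda>x. (\<integral>\<^sup>+ y. h y \<partial>K x) + emeasure (K x) (space E) * ennreal m * (\<integral>\<^sup>+ y. h y \<partial>\<gamma>))
      \<in> borel_measurable E" by measurable
qed (auto simp: assms)

section \<open>Powers of \<open>M\<close> and their decomposition at the first jump according to
  \<open>\<gamma>\<close>\<close>

lemma M_pow_measurable: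
  assumes "A \<in> sets E" shows "(\<lambda>x. kernel_pow M n x A) \<in> borel_measurable E"
  using assms by (induction n) (auto intro: nn_integral_M_measurable)

definition M_mass :: "'a set \<Rightarrow> nat \<Rightarrow> ennreal" where
  "M_mass A n = (\<integral>\<^sup>+ y. kernel_pow M n y A \<partial>\<gamma>)"

definition K_mass :: "'a set \<Rightarrow> nat \<Rightarrow> ennreal" where
  "K_mass A n = (\<integral>\<^sup>+ y. kernel_pow K n y A \<partial>\<gamma>)"

lemma K_mass_space: "K_mass (space E) n = d n"
  by (simp add: K_mass_def d_coeff_def)

lemma M_pow_decomposition:
  assumes A: "A \<in> sets E" and x: "x \<in> space E"
  shows "kernel_pow M (Suc n) x A = kernel_pow K (Suc n) x A +
    (\<Sum>j\<le>n. ennreal m * kernel_pow K (Suc j) x (space E) * M_mass A (n - j))"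
  using x
proof (induction n arbitrary: x)
  case 0
  then show ?case using A
    by (simp add: sets_kernel emeasure_M_kernel sets_\<gamma> M_mass_def mult_ac)
next
  case (Suc n)
  note x = Suc.prems
  \<comment> \<open>The first transition follows either \<open>K\<close>, after which the induction
    hypothesis applies and \<open>j\<close> rises by one, or \<open>\<gamma>\<close>, which is the
    term \<open>j = 0\<close>.\<close>
  have "kernel_pow M (Suc (Suc n)) x A = (\<integral>\<^sup>+ y. kernel_pow M (Suc n) y A \<partial>K x) +
      emeasure (K x) (space E) * ennreal m * M_mass A (Suc n)"
    unfolding kernel_pow.simps(2)[of M "Suc n"] M_mass_def
    by (rule nn_integral_M_kernel[OF x M_pow_measurable[OF A]])
  also have "(\<integral>\<^sup>+ y. kernel_pow M (Suc n) y A \<partial>K x) =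
      (\<integral>\<^sup>+ y. kernel_pow K (Suc n) y A +
        (\<Sum>j\<le>n. ennreal m * kernel_pow K (Suc j) y (space E) * M_mass A (n - j)) \<partial>K x)"
    using Suc.IH by (intro nn_integral_cong) (simp only: space_kernel[OF x])
  also have "\<dots> = kernel_pow K (Suc (Suc n)) x A +
      (\<Sum>j\<le>n. ennreal m * kernel_pow K (Suc (Suc j)) x (space E) * M_mass A (n - j))"
    using A x kernel_pow_measurable
    by (simp del: kernel_pow.simps(2) add: kernel_pow.simps(2)[of K "Suc _"] nn_integral_add nn_integral_sum
        nn_integral_cmult nn_integral_multc borel_measurable_kernel)
  finally show ?case
    using x by (subst sum.atMost_Suc_shift) (simp add: sets_kernel add_ac mult_ac)
qed

text \<open>The decomposition integrated over the starting point. Multiplied by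
  \<open>R ^ Suc n\<close> it becomes an equation as in
  \<open>renewal_equation_tendsto\<close>.\<close>

lemma M_mass_renewal:
  assumes A: "A \<in> sets E"
  shows "M_mass A (Suc n) = K_mass A (Suc n) + (\<Sum>j\<le>n. ennreal m * d (Suc j) * M_mass A (n - j))"
proof -
  have "M_mass A (Suc n) = (\<integral>\<^sup>+ x. kernel_pow K (Suc n) x A +
    (\<Sum>j\<le>n. ennreal m * kernel_pow K (Suc j) x (space E) * M_mass A (n - j)) \<partial>\<gamma>)"
    unfolding M_mass_def[of A "Suc n"]
    by (intro nn_integral_cong M_pow_decomposition[OF A]) (simp add: space_\<gamma>)
  also have "\<dots> = K_mass A (Suc n) + (\<Sum>j\<le>n. ennreal m * d (Suc j) * M_mass A (n - j))"
    using A kernel_pow_measurable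
    by (simp del: kernel_pow.simps(2) add: K_mass_def d_coeff_def nn_integral_add nn_integral_sum
        nn_integral_cmult nn_integral_multc borel_measurable_\<gamma>)
  finally show ?thesis .
qed

text \<open>One transition multiplies the mass by at most \<open>1 + m\<close>. This crude bound
  makes \<open>M_mass\<close> finite, so that the renewal equation can be read in the reals.\<close>

lemma M_pow_le:
  assumes A: "A \<in> sets E" and x: "x \<in> space E"
  shows "kernel_pow M n x A \<le> ennreal (1 + m) ^ n"
  using x
proof (induction n arbitrary: x)
  case (Suc n)
  have "emeasure (M x) (space E) \<le> 1 + 1 * ennreal m * 1"
    using Suc.prems emeasure_kernel_le_1[OF Suc.prems] m_pos emeasure_\<gamma>_space
    by (auto simp: emeasure_M_kernel sets_kernel sets_\<gamma> intro!: add_mono mult_right_le_one_le mult_mono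
        simp del: mult_1_right mult_1_left)
  then have mass: "emeasure (M x) (space E) \<le> ennreal (1 + m)"
    using m_pos by simp
  have "kernel_pow M (Suc n) x A \<le> (\<integral>\<^sup>+ y. ennreal (1 + m) ^ n \<partial>M x)"
    unfolding kernel_pow.simps by (intro nn_integral_mono Suc.IH) simp
  also have "\<dots> \<le> ennreal (1 + m) ^ n * ennreal (1 + m)"
    using mass by (simp add: mult_left_mono)
  finally show ?case by (simp add: mult.commute)
qed (auto split: split_indicator)

lemma M_mass_finite: "A \<in> sets E \<Longrightarrow> M_mass A n < \<infinity>"
proof -
  assume A: "A \<in> sets E"
  have "M_mass A n \<le> (\<integral>\<^sup>+ y. ennreal (1 + m) ^ n \<partial>\<gamma>)"
    unfolding M_mass_def using A by (intro nn_integral_mono M_pow_le) (simp_all add: space_\<gamma>)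
  also have "\<dots> < \<infinity>"
    using m_pos by (simp add: space_\<gamma> emeasure_\<gamma>_space ennreal_power del: ennreal_plus)
  finally show ?thesis .
qed

lemma K_mass_le_d: "K_mass A n \<le> d n"
  unfolding K_mass_def d_coeff_def
proof (intro nn_integral_mono)
  fix x assume "x \<in> space \<gamma>"
  then show "kernel_pow K n x A \<le> kernel_pow K n x (space E)"
    unfolding kernel_pow_eq_iter by (intro kernel_iter_mono) (auto simp: space_\<gamma> split: split_indicator)
qed

lemma d_antimono: "i \<le> j \<Longrightarrow> d j \<le> d i"
  unfolding d_coeff_def by (intro nn_integral_mono kernel_pow_space_decreasing) (simp_all add: space_\<gamma>)

lemma d_0: "d 0 = 1"
  using emeasure_\<gamma>_space by (simp add: d_coeff_def sets_\<gamma>)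

lemma d_finite: "d n < \<infinity>"
  using d_antimono[of 0 n] by (simp add: d_0 le_less_trans)

lemma K_mass_finite: "K_mass A n < \<infinity>"
  using K_mass_le_d d_finite by (rule le_less_trans)

subsection \<open>Existence and uniqueness of the root\<close>

lemma f_gen_finite_below_R_star:
  assumes "0 < s" "ennreal s < R_star E K \<gamma>" shows "f_gen E K \<gamma> s < \<infinity>"
proof (rule ccontr)
  assume "\<not> f_gen E K \<gamma> s < \<infinity>"
  then have "R_star E K \<gamma> \<le> ennreal s"
    unfolding R_star_def using assms(1) by (intro INF_lower) (simp add: less_top[symmetric])
  then show False using assms(2) by simp
qed

text \<open>As \<open>d\<close> is decreasing, \<open>d 1 = 0\<close> would make \<open>f\<close>
  vanish identically, and with it \<open>f_at_R_star\<close> in both cases of its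
  definition.\<close>

lemma d_1_pos:
  assumes "ennreal (1 / m) \<le> f_at_R_star E K \<gamma>" shows "0 < d 1"
proof (rule ccontr)
  assume "\<not> 0 < d 1"
  then have "d 1 = 0" by simp
  then have "d (Suc n) = 0" for n
    using d_antimono[of 1 "Suc n"] by simp
  then have "f_gen E K \<gamma> = (\<lambda>_. 0)" by (simp add: f_gen_def fun_eq_iff)
  then have "f_at_R_star E K \<gamma> = 0"
    by (simp add: f_at_R_star_def tendsto_Lim)
  then show False using assms m_pos by simp
qed

definition D :: "nat \<Rightarrow> real" where
  "D n = enn2real (d (Suc n))"

lemma D_nonneg: "0 \<le> D n"
  by (simp add: D_def)

lemma f_gen_eq_D: "0 \<le> s \<Longrightarrow> f_gen E K \<gamma> s = (\<Sum>n. ennreal (D n * s ^ Suc n))"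
  using d_finite
  by (simp add: f_gen_def D_def ennreal_mult ennreal_power less_top del: power_Suc)

text \<open>This is the right end point for the intermediate value theorem. \<open>R_star\<close>
  itself cannot always serve, since it or the value of \<open>f\<close> there may be
  infinite.\<close>

lemma exists_argument_above:
  assumes large: "ennreal (1 / m) \<le> f_at_R_star E K \<gamma>"
  obtains s where "0 < s" "ennreal (1 / m) \<le> f_gen E K \<gamma> s" "f_gen E K \<gamma> s < \<infinity>"
proof (cases "R_star E K \<gamma>")
  case top
  have D0: "0 < D 0"
    using d_1_pos[OF large] d_finite[of 1] by (simp add: D_def enn2real_positive_iff)
  \<comment> \<open>With this choice the first term of the series alone equals
    \<open>1 / m\<close>.\<close>
  define s where "s = 1 / (m * D 0)"
  have s: "0 < s" using D0 m_pos by (simp add: s_def)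
  have "ennreal (1 / m) = (\<Sum>n<1. ennreal (D n * s ^ Suc n))"
    using D0 by (simp add: s_def)
  also have "\<dots> \<le> f_gen E K \<gamma> s"
    unfolding f_gen_eq_D[OF less_imp_le[OF s]] by (intro sum_le_suminf) auto
  finally show ?thesis
    using that[OF s] f_gen_finite_below_R_star[OF s] top by simp
next
  case (real r)
  then have large': "ennreal (1 / m) \<le> f_gen E K \<gamma> r"
    using large by (simp add: f_at_R_star_def)
  \<comment> \<open>This excludes \<open>R_star = 0\<close>, where \<open>f\<close> would not reach
    \<open>1 / m\<close>.\<close>
  have "f_gen E K \<gamma> 0 = 0" by (simp add: f_gen_def)
  then have r: "0 < r" using large' real m_pos by (cases "r = 0") auto
  show ?thesis
  proof (cases "f_gen E K \<gamma> r < \<infinity>")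
    case True
    then show ?thesis using that r large' by blast
  next
    case False
    \<comment> \<open>If \<open>f\<close> is infinite at \<open>r\<close>, some partial sum exceeds
      \<open>1 / m\<close> there. Being a polynomial, it still does so slightly to the left of
      \<open>r\<close>, where \<open>f\<close> is finite.\<close>
    then have "ennreal (1 / m) < (\<Sum>n. ennreal (D n * r ^ Suc n))"
      using r by (subst f_gen_eq_D[symmetric]) (simp_all add: less_top[symmetric])
    then obtain N where "ennreal (1 / m) < (\<Sum>n<N. ennreal (D n * r ^ Suc n))"
      by (auto simp: suminf_eq_SUP less_SUP_iff)
    also have "\<dots> = ennreal (\<Sum>n<N. D n * r ^ Suc n)"
      using r by (intro sum_ennreal) (simp add: D_nonneg)
    finally have "1 / m < (\<Sum>n<N. D n * r ^ Suc n)"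
      using m_pos by (simp add: ennreal_less_iff)
    moreover have "((\<lambda>s. \<Sum>n<N. D n * s ^ Suc n) \<longlongrightarrow> (\<Sum>n<N. D n * r ^ Suc n)) (at_left r)"
      by (intro tendsto_intros)
    ultimately have "\<forall>\<^sub>F s in at_left r. 1 / m < (\<Sum>n<N. D n * s ^ Suc n)"
      by (rule order_tendstoD(1)[rotated])
    then have "\<forall>\<^sub>F s in at_left r. 1 / m < (\<Sum>n<N. D n * s ^ Suc n) \<and> s \<in> {0<..<r}"
      using eventually_at_left_real[OF r] by (rule eventually_conj)
    then obtain s where s: "1 / m < (\<Sum>n<N. D n * s ^ Suc n)" "0 < s" "s < r"
      using eventually_happens'[of "at_left r"] by (auto simp: trivial_limit_at_left_real)
    have "ennreal (1 / m) \<le> ennreal (\<Sum>n<N. D n * s ^ Suc n)"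
      using s by (intro ennreal_leI) simp
    also have "\<dots> = (\<Sum>n<N. ennreal (D n * s ^ Suc n))"
      using s by (intro sum_ennreal[symmetric]) (simp add: D_nonneg)
    also have "\<dots> \<le> f_gen E K \<gamma> s"
      unfolding f_gen_eq_D[OF less_imp_le[OF s(2)]] by (intro sum_le_suminf) auto
    finally show ?thesis
      using that s f_gen_finite_below_R_star[OF s(2)] real by (simp add: ennreal_less_iff)
  qed
qed

lemma f_gen_eq_iff:
  assumes "0 \<le> s" "0 \<le> y"
  shows "f_gen E K \<gamma> s = ennreal y \<longleftrightarrow> (\<lambda>n. D n * s ^ Suc n) sums y"
proof -
  have "f_gen E K \<gamma> s = ennreal y \<longleftrightarrow> (\<lambda>n. ennreal (D n * s ^ Suc n)) sums ennreal y"
    by (simp add: f_gen_eq_D[OF assms(1)] sums_iff)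
  also have "\<dots> \<longleftrightarrow> (\<lambda>n. D n * s ^ Suc n) sums y"
    using assms D_nonneg by (intro sums_ennreal) auto
  finally show ?thesis .
qed

text \<open>Existence is the intermediate value theorem on \<open>[0, s]\<close>, with continuity
  from the Weierstrass test and the terms at \<open>s\<close> as majorant. Uniqueness holds because
  the linear coefficient \<open>D 0\<close> is positive.\<close>

lemma ex1_root:
  assumes large: "ennreal (1 / m) \<le> f_at_R_star E K \<gamma>"
  shows "\<exists>!R. 0 < R \<and> ennreal m * f_gen E K \<gamma> R = 1"
proof -
  have root_iff: "ennreal m * y = 1 \<longleftrightarrow> y = ennreal (1 / m)" for y
  proof
    assume "ennreal m * y = 1"
    then have "ennreal (1 / m) = (ennreal (1 / m) * ennreal m) * y" by (simp add: mult.assoc)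
    then show "y = ennreal (1 / m)" using m_pos by (simp flip: ennreal_mult)
  qed (use m_pos in \<open>simp flip: ennreal_mult\<close>)
  obtain s where s: "0 < s" "ennreal (1 / m) \<le> f_gen E K \<gamma> s" "f_gen E K \<gamma> s < \<infinity>"
    using exists_argument_above[OF large] .
  have summable_s: "summable (\<lambda>n. D n * s ^ Suc n)"
  proof (rule summable_suminf_not_top)
    show "(\<Sum>n. ennreal (D n * s ^ Suc n)) \<noteq> top"
      using s by (subst f_gen_eq_D[symmetric]) auto
  qed (use s D_nonneg in auto)
  define F where "F x = (\<Sum>n. D n * x ^ Suc n)" for x
  have le: "norm (D n * x ^ Suc n) \<le> D n * s ^ Suc n" if "x \<in> {0..s}" for n x
    using that by (auto simp: abs_mult D_nonneg power_abs intro!: mult_left_mono power_mono simp del: power_Suc)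
  have "uniform_limit {0..s} (\<lambda>n x. \<Sum>i<n. D i * x ^ Suc i) F sequentially"
    unfolding F_def by (rule Weierstrass_m_test[OF le summable_s])
  then have "continuous_on {0..s} F"
    by (rule uniform_limit_theorem[rotated]) (auto intro!: always_eventually continuous_intros)
  moreover have "F 0 = 0" by (simp add: F_def)
  moreover have sums_F: "(\<lambda>n. D n * x ^ Suc n) sums F x" if "x \<in> {0..s}" for x
    unfolding F_def by (intro summable_sums summable_comparison_test'[OF summable_s le[OF that]])
  moreover have "1 / m \<le> F s"
  proof -
    have "0 \<le> F s" unfolding F_def using s D_nonneg by (intro suminf_nonneg summable_s) auto
    then have "f_gen E K \<gamma> s = ennreal (F s)" using s sums_F[of s] by (subst f_gen_eq_iff) auto
    then show ?thesis using s(2) \<open>0 \<le> F s\<close> by simp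
  qed
  ultimately obtain R where R: "0 \<le> R" "R \<le> s" "F R = 1 / m"
    using IVT'[of F 0 "1 / m" s] s m_pos by auto
  have "R \<noteq> 0" using R m_pos \<open>F 0 = 0\<close> by auto
  moreover have "f_gen E K \<gamma> R = ennreal (1 / m)"
    using R sums_F[of R] m_pos by (subst f_gen_eq_iff) auto
  ultimately have "0 < R \<and> ennreal m * f_gen E K \<gamma> R = 1" using R by (simp add: root_iff)
  moreover have "a = b"
    if "0 < a \<and> ennreal m * f_gen E K \<gamma> a = 1" "0 < b \<and> ennreal m * f_gen E K \<gamma> b = 1" for a b
    using that
  proof (induction a b rule: linorder_wlog)
    case (le a b)
    \<comment> \<open>For \<open>a \<le> b\<close> the differences of the terms are nonnegative and
      sum to 0, so the first one, \<open>D 0 * (b - a)\<close>, cannot be positive.\<close>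
    have "(\<lambda>n. D n * a ^ Suc n) sums (1 / m)" "(\<lambda>n. D n * b ^ Suc n) sums (1 / m)"
      using le m_pos f_gen_eq_iff[of a "1 / m"] f_gen_eq_iff[of b "1 / m"]
      unfolding root_iff by (simp_all del: power_Suc)
    then have diff: "(\<lambda>n. D n * b ^ Suc n - D n * a ^ Suc n) sums 0"
      using sums_diff by fastforce
    have "0 \<le> D n * b ^ Suc n - D n * a ^ Suc n" for n
      using le by (simp add: D_nonneg mult_left_mono power_mono del: power_Suc)
    then have "(\<Sum>n<1. D n * b ^ Suc n - D n * a ^ Suc n) \<le> 0"
      using sum_le_suminf[OF sums_summable[OF diff], of "{..<1}"] sums_unique[OF diff] by simp
    then have "D 0 * (b - a) \<le> 0" by (simp add: algebra_simps)
    moreover have "0 < D 0"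
      using d_1_pos[OF large] d_finite[of 1] by (simp add: D_def enn2real_positive_iff)
    ultimately show ?case using le by (simp add: mult_le_0_iff)
  qed auto
  ultimately show ?thesis by blast
qed

end

section \<open>Eigenfunction, eigenmeasure and limit\<close>

locale positive_root = rank_one_perturbation +
  fixes R :: real
  assumes R_pos: "0 < R" and root: "ennreal m * f_gen E K \<gamma> R = 1"
begin

abbreviation "E\<^sub>R \<equiv> finite_pts E K R"
abbreviation "c \<equiv> ennreal (m / (1 + m))"
abbreviation "f' \<equiv> f_gen_deriv E K \<gamma> R"
abbreviation "u \<equiv> u_fun E K m R"
abbreviation "\<nu> \<equiv> nu_measure E K \<gamma> m R"

section \<open>The set of finite points and the eigenfunction \<open>u\<close>\<close>

definition S :: "'a \<Rightarrow> ennreal" where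
  "S x = (\<Sum>n. ennreal R ^ Suc n * kernel_pow K (Suc n) x (space E))"

lemma c_m: "c * ennreal (1 + m) = ennreal m"
  using m_pos by (simp flip: ennreal_mult ennreal_plus)

lemma gen_measurable [measurable]:
  "A \<in> sets E \<Longrightarrow> (\<lambda>x. kernel_gen K R x A) \<in> borel_measurable E"
  unfolding kernel_gen_def using kernel_pow_measurable by measurable

lemma S_measurable [measurable]: "S \<in> borel_measurable E"
  unfolding S_def using kernel_pow_measurable[OF sets.top] by measurable

lemma gen_split_head:
  "kernel_gen K R x A = indicator A x + (\<Sum>n. ennreal R ^ Suc n * kernel_pow K (Suc n) x A)"
  unfolding kernel_gen_def
  using suminf_offset[of "\<lambda>n. ennreal R ^ n * kernel_pow K n x A" 1] by (simp add: add.commute)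

text \<open>Starting the series \<open>S\<close> at the first power expresses
  \<open>K^(R)(x, E) - 1\<close> without subtraction, so it makes sense where the value is
  infinite.\<close>

lemma gen_eq_S: "x \<in> space E \<Longrightarrow> kernel_gen K R x (space E) = 1 + S x"
  by (simp add: gen_split_head S_def)

lemma finite_pts_eq: "E\<^sub>R = {x \<in> space E. S x < \<infinity>}"
  by (auto simp: finite_pts_def gen_eq_S)

lemma finite_pts_measurable [measurable]: "E\<^sub>R \<in> sets E"
  unfolding finite_pts_eq by measurable

lemma finite_pts_space: "x \<in> E\<^sub>R \<Longrightarrow> x \<in> space E"
  by (simp add: finite_pts_eq)

lemma u_eq_S:
  assumes "x \<in> E\<^sub>R" shows "u x = (1 + m) * enn2real (S x)"
  using assms by (cases "S x") (auto simp: u_fun_def finite_pts_eq gen_eq_S simp flip: ennreal_1 ennreal_plus)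

lemma ennreal_u_eq_S:
  assumes "x \<in> E\<^sub>R" shows "ennreal (u x) = ennreal (1 + m) * S x"
  using assms m_pos unfolding u_eq_S[OF assms]
  by (cases "S x") (auto simp: finite_pts_eq ennreal_mult simp del: ennreal_plus)

lemma u_nonneg: "0 \<le> u x"
  using u_eq_S[of x] m_pos by (cases "x \<in> E\<^sub>R") (auto simp: u_fun_def)

lemma u_measurable [measurable]: "u \<in> borel_measurable E"
proof -
  have [measurable]: "(\<lambda>x. kernel_gen K R x (space E)) \<in> borel_measurable E" by measurable
  show ?thesis unfolding u_fun_def[abs_def] by measurable
qed

text \<open>The cutoff in \<open>u\<close> acts only on a null set of \<open>N\<close>, so
  \<open>u\<close> may be traded for the series \<open>(1 + m) * S\<close>.\<close>

lemma nn_integral_u: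
  assumes N: "sets N = sets E" and "AE x in N. x \<in> E\<^sub>R"
  shows "(\<integral>\<^sup>+ x. ennreal (u x) \<partial>N) = ennreal (1 + m) * (\<integral>\<^sup>+ x. S x \<partial>N)"
proof -
  have "(\<integral>\<^sup>+ x. ennreal (u x) \<partial>N) = (\<integral>\<^sup>+ x. ennreal (1 + m) * S x \<partial>N)"
    using assms(2) by (intro nn_integral_cong_AE) (auto elim!: eventually_mono simp: ennreal_u_eq_S)
  then show ?thesis
    by (simp add: nn_integral_cmult measurable_cong_sets[OF N refl])
qed

text \<open>Taking one factor \<open>R\<close> and the first transition out of every term gives
  \<open>S = R * K (1 + S)\<close>. Both the invariance of the finite points and the eigenvalue
  equation for \<open>u\<close> rest on it.\<close>

lemma S_eq_kernel_integral:
  assumes x: "x \<in> space E"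
  shows "S x = ennreal R * (emeasure (K x) (space E) + (\<integral>\<^sup>+ y. S y \<partial>K x))"
proof -
  have "S x = (\<Sum>n. ennreal R * (\<integral>\<^sup>+ y. ennreal R ^ n * kernel_pow K n y (space E) \<partial>K x))"
    unfolding S_def using kernel_pow_measurable[OF sets.top]
    by (simp add: nn_integral_cmult borel_measurable_kernel[OF x] mult.assoc)
  also have "\<dots> = ennreal R * (\<integral>\<^sup>+ y. kernel_gen K R y (space E) \<partial>K x)"
    unfolding kernel_gen_def using kernel_pow_measurable[OF sets.top]
    by (subst nn_integral_suminf) (simp_all add: borel_measurable_kernel[OF x])
  also have "(\<integral>\<^sup>+ y. kernel_gen K R y (space E) \<partial>K x) = (\<integral>\<^sup>+ y. indicator (space E) y + S y \<partial>K x)"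
    by (intro nn_integral_cong) (simp add: gen_eq_S space_kernel[OF x])
  also have "\<dots> = emeasure (K x) (space E) + (\<integral>\<^sup>+ y. S y \<partial>K x)"
    by (subst nn_integral_add) (simp_all add: borel_measurable_kernel[OF x] sets_kernel[OF x])
  finally show ?thesis .
qed

text \<open>By \<open>S = R * K (1 + S)\<close> with \<open>R > 0\<close>, finiteness of
  \<open>S x\<close> forces \<open>S\<close> to be integrable under \<open>K x\<close>.\<close>

lemma AE_kernel_finite_pts:
  assumes x: "x \<in> E\<^sub>R" shows "AE y in K x. y \<in> E\<^sub>R"
proof -
  note xE = finite_pts_space[OF x]
  have "ennreal R * (\<integral>\<^sup>+ y. S y \<partial>K x) \<le> S x"
    unfolding S_eq_kernel_integral[OF xE] by (intro mult_left_mono) auto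
  also have "\<dots> < \<infinity>" using x by (simp add: finite_pts_eq)
  finally have "(\<integral>\<^sup>+ y. S y \<partial>K x) \<noteq> \<infinity>"
    using R_pos by (auto simp: ennreal_mult_eq_top_iff)
  then have "AE y in K x. S y \<noteq> \<infinity>"
    by (intro nn_integral_noteq_infinite) (simp_all add: borel_measurable_kernel[OF xE])
  then show ?thesis
    using AE_space by eventually_elim (auto simp: finite_pts_eq space_kernel[OF xE] less_top)
qed

lemma f_gen_eq: "f_gen E K \<gamma> R = (\<Sum>n. ennreal R ^ Suc n * d (Suc n))"
  unfolding f_gen_def by (intro arg_cong[where f = suminf] ext mult.commute)

lemma nn_integral_S: "(\<integral>\<^sup>+ x. S x \<partial>\<gamma>) = f_gen E K \<gamma> R"
  unfolding S_def f_gen_eq d_coeff_def using kernel_pow_measurable[OF sets.top]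
  by (subst nn_integral_suminf)
    (simp_all del: kernel_pow.simps power_Suc add: nn_integral_cmult borel_measurable_\<gamma>)

lemma f_gen_root: "f_gen E K \<gamma> R = ennreal (1 / m)"
proof -
  have "f_gen E K \<gamma> R = ennreal (1 / m) * (ennreal m * f_gen E K \<gamma> R)"
    using m_pos by (simp add: mult.assoc[symmetric] flip: ennreal_mult)
  then show ?thesis by (simp add: root)
qed

text \<open>The integral of \<open>S\<close> under \<open>\<gamma>\<close> is
  \<open>f(R) = 1 / m\<close>, which is finite.\<close>

lemma AE_\<gamma>_finite_pts: "AE x in \<gamma>. x \<in> E\<^sub>R"
proof -
  have "AE x in \<gamma>. S x \<noteq> \<infinity>"
    by (intro nn_integral_noteq_infinite) (simp_all add: borel_measurable_\<gamma> nn_integral_S f_gen_root)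
  then show ?thesis
    using AE_space by eventually_elim (auto simp: finite_pts_eq space_\<gamma> less_top)
qed

lemma nn_integral_u_\<gamma>: "(\<integral>\<^sup>+ x. ennreal (u x) \<partial>\<gamma>) = ennreal ((1 + m) / m)"
  using m_pos by (simp add: nn_integral_u[OF sets_\<gamma> AE_\<gamma>_finite_pts] nn_integral_S f_gen_root
      del: ennreal_plus flip: ennreal_mult)

text \<open>The integral of \<open>u\<close> under \<open>\<gamma>\<close> is
  \<open>(1 + m) / m\<close>, so the jump part of \<open>M\<close> contributes
  \<open>(1 + m) * K(x, E)\<close>. Together with the \<open>K\<close> part this is
  \<open>(1 + m) * K (1 + S) = (1 + m) * S / R\<close>.\<close>

lemma u_eigenfunction:
  assumes x: "x \<in> E\<^sub>R"
  shows "(\<integral>\<^sup>+ y. ennreal (u y) \<partial>M x) = ennreal (1 / R * u x)"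
proof -
  note xE = finite_pts_space[OF x]
  have m1: "ennreal m * ennreal ((1 + m) / m) = ennreal (1 + m)"
    using m_pos by (simp flip: ennreal_mult)
  have "(\<integral>\<^sup>+ y. ennreal (u y) \<partial>M x) = ennreal (1 + m) * (\<integral>\<^sup>+ y. S y \<partial>K x) +
      emeasure (K x) (space E) * (ennreal m * ennreal ((1 + m) / m))"
    by (simp add: nn_integral_M_kernel[OF xE] nn_integral_u_\<gamma> mult.assoc
        nn_integral_u[OF sets_kernel[OF xE] AE_kernel_finite_pts[OF x]])
  also have "\<dots> = ennreal (1 + m) * (emeasure (K x) (space E) + (\<integral>\<^sup>+ y. S y \<partial>K x))"
    unfolding m1 by (simp add: distrib_left mult_ac add_ac del: ennreal_plus)
  also have "\<dots> = ennreal (1 / R) * (ennreal (1 + m) * S x)"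
  proof -
    have "ennreal (1 / R) * (ennreal (1 + m) * (ennreal R * X)) = ennreal (1 + m) * X" for X
    proof -
      have "ennreal (1 / R) * (ennreal (1 + m) * (ennreal R * X)) =
          (ennreal (1 / R) * ennreal R) * (ennreal (1 + m) * X)" by (simp only: mult_ac)
      then show ?thesis using R_pos by (simp flip: ennreal_mult)
    qed
    then show ?thesis by (simp only: S_eq_kernel_integral[OF xE])
  qed
  also have "\<dots> = ennreal (1 / R * u x)"
    using R_pos u_nonneg by (simp only: ennreal_u_eq_S[OF x, symmetric]) (simp flip: ennreal_mult)
  finally show ?thesis .
qed

section \<open>The eigenmeasure \<open>\<nu>\<close>\<close>

definition \<Phi> :: "('a \<Rightarrow> ennreal) \<Rightarrow> ennreal" where
  "\<Phi> h = c * (\<Sum>n. ennreal R ^ n * (\<integral>\<^sup>+ x. kernel_iter K n h x \<partial>\<gamma>))"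

lemma \<Phi>_cong:
  assumes "\<And>x. x \<in> space E \<Longrightarrow> f x = g x" shows "\<Phi> f = \<Phi> g"
proof -
  have "(\<integral>\<^sup>+ x. kernel_iter K n f x \<partial>\<gamma>) = (\<integral>\<^sup>+ x. kernel_iter K n g x \<partial>\<gamma>)" for n
    using assms by (intro nn_integral_cong kernel_iter_cong) (auto simp: space_\<gamma>)
  then show ?thesis by (simp add: \<Phi>_def)
qed

lemma \<Phi>_suminf:
  assumes h: "\<And>i. h i \<in> borel_measurable E"
  shows "\<Phi> (\<lambda>x. \<Sum>i. h i x) = (\<Sum>i. \<Phi> (h i))"
proof -
  have "(\<integral>\<^sup>+ x. kernel_iter K n (\<lambda>x. \<Sum>i. h i x) x \<partial>\<gamma>) = (\<Sum>i. \<integral>\<^sup>+ x. kernel_iter K n (h i) x \<partial>\<gamma>)" for n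
  proof -
    have "(\<integral>\<^sup>+ x. kernel_iter K n (\<lambda>x. \<Sum>i. h i x) x \<partial>\<gamma>) = (\<integral>\<^sup>+ x. (\<Sum>i. kernel_iter K n (h i) x) \<partial>\<gamma>)"
      by (intro nn_integral_cong kernel_iter_suminf h) (simp add: space_\<gamma>)
    then show ?thesis using h by (simp add: nn_integral_suminf borel_measurable_\<gamma>)
  qed
  then have "\<Phi> (\<lambda>x. \<Sum>i. h i x) =
      (\<Sum>n. \<Sum>i. c * (ennreal R ^ n * (\<integral>\<^sup>+ x. kernel_iter K n (h i) x \<partial>\<gamma>)))"
    by (simp add: \<Phi>_def)
  also have "\<dots> = (\<Sum>i. \<Sum>n. c * (ennreal R ^ n * (\<integral>\<^sup>+ x. kernel_iter K n (h i) x \<partial>\<gamma>)))"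
    by (rule suminf_suminf_swap)
  also have "\<dots> = (\<Sum>i. \<Phi> (h i))"
    by (simp add: \<Phi>_def)
  finally show ?thesis .
qed

lemma nu_fun_eq_\<Phi>:
  assumes A: "A \<in> sets E" shows "nu_fun K \<gamma> m R A = \<Phi> (indicator A)"
proof -
  have "(\<lambda>x. kernel_pow K n x A) \<in> borel_measurable \<gamma>" for n
    using kernel_pow_measurable[OF A] by (simp add: borel_measurable_\<gamma>)
  then show ?thesis
    unfolding nu_fun_def \<Phi>_def kernel_gen_def
    by (subst nn_integral_suminf) (auto simp: nn_integral_cmult kernel_pow_eq_iter)
qed

lemma nu_fun_eq_K_mass:
  "A \<in> sets E \<Longrightarrow> nu_fun K \<gamma> m R A = c * (\<Sum>n. ennreal R ^ n * K_mass A n)"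
  by (simp add: nu_fun_eq_\<Phi> \<Phi>_def K_mass_def kernel_pow_eq_iter)

lemma sets_\<nu>: "sets \<nu> = sets E"
  by (simp add: nu_measure_def sets.sigma_sets_eq)

text \<open>On a disjoint family the indicators sum to the indicator of the union, so
  \<open>\<Phi>_suminf\<close> gives the countable additivity that \<open>measure_of\<close>
  requires.\<close>

lemma emeasure_\<nu>:
  assumes A: "A \<in> sets E" shows "emeasure \<nu> A = nu_fun K \<gamma> m R A"
proof (rule emeasure_measure_of[OF nu_measure_def])
  show "sets E \<subseteq> Pow (space E)" by (rule sets.space_closed)
  show "A \<in> sets \<nu>" using A by (simp add: sets_\<nu>)
  show "positive (sets \<nu>) (nu_fun K \<gamma> m R)"
    using nu_fun_eq_K_mass[of "{}"] by (simp add: positive_def K_mass_def)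
  show "countably_additive (sets \<nu>) (nu_fun K \<gamma> m R)"
  proof (rule countably_additiveI)
    fix F :: "nat \<Rightarrow> 'a set"
    assume F: "range F \<subseteq> sets \<nu>" "disjoint_family F" "(\<Union>i. F i) \<in> sets \<nu>"
    then have FE: "F i \<in> sets E" for i by (auto simp: sets_\<nu>)
    have "(\<Sum>i. nu_fun K \<gamma> m R (F i)) = \<Phi> (\<lambda>x. \<Sum>i. indicator (F i) x)"
      using FE by (simp add: nu_fun_eq_\<Phi> \<Phi>_suminf)
    also have "\<dots> = nu_fun K \<gamma> m R (\<Union>i. F i)"
      using F by (simp add: suminf_indicator nu_fun_eq_\<Phi> sets_\<nu>)
    finally show "(\<Sum>i. nu_fun K \<gamma> m R (F i)) = nu_fun K \<gamma> m R (\<Union>i. F i)" .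
  qed
qed

text \<open>\<open>\<Phi>\<close> inherits linearity and continuity from below from the iterates of
  \<open>K\<close>, which identifies it as integration against \<open>\<nu>\<close>.\<close>

lemma nn_integral_\<nu>:
  assumes h: "h \<in> borel_measurable E"
  shows "(\<integral>\<^sup>+ x. h x \<partial>\<nu>) = \<Phi> h"
proof (rule nn_integral_eq_functional[OF sets_\<nu> _ \<Phi>_cong _ _ _ h])
  show "emeasure \<nu> A = \<Phi> (indicator A)" if "A \<in> sets E" for A
    using that by (simp add: emeasure_\<nu> nu_fun_eq_\<Phi>)
  show "\<Phi> (\<lambda>x. a * f x) = a * \<Phi> f" if f: "f \<in> borel_measurable E" for f a
  proof -
    have "(\<integral>\<^sup>+ x. kernel_iter K n (\<lambda>x. a * f x) x \<partial>\<gamma>) = (\<integral>\<^sup>+ x. a * kernel_iter K n f x \<partial>\<gamma>)" for n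
      by (intro nn_integral_cong kernel_iter_cmult f) (simp add: space_\<gamma>)
    then have "(\<integral>\<^sup>+ x. kernel_iter K n (\<lambda>x. a * f x) x \<partial>\<gamma>) = a * (\<integral>\<^sup>+ x. kernel_iter K n f x \<partial>\<gamma>)" for n
      using f by (simp add: nn_integral_cmult borel_measurable_\<gamma>)
    then show ?thesis by (simp add: \<Phi>_def mult.left_commute[of _ a])
  qed
  show "\<Phi> (\<lambda>x. f x + g x) = \<Phi> f + \<Phi> g"
    if f: "f \<in> borel_measurable E" and g: "g \<in> borel_measurable E" for f g
  proof -
    have "(\<integral>\<^sup>+ x. kernel_iter K n (\<lambda>x. f x + g x) x \<partial>\<gamma>) =
        (\<integral>\<^sup>+ x. kernel_iter K n f x + kernel_iter K n g x \<partial>\<gamma>)" for n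
      by (intro nn_integral_cong kernel_iter_add f g) (simp add: space_\<gamma>)
    then have "(\<integral>\<^sup>+ x. kernel_iter K n (\<lambda>x. f x + g x) x \<partial>\<gamma>) =
        (\<integral>\<^sup>+ x. kernel_iter K n f x \<partial>\<gamma>) + (\<integral>\<^sup>+ x. kernel_iter K n g x \<partial>\<gamma>)" for n
      using f g by (simp add: nn_integral_add borel_measurable_\<gamma>)
    then show ?thesis by (simp add: \<Phi>_def distrib_left suminf_add[symmetric])
  qed
  show "\<Phi> (\<lambda>x. SUP i. f i x) = (SUP i. \<Phi> (f i))"
    if f: "\<And>i. f i \<in> borel_measurable E" "incseq f" for f :: "nat \<Rightarrow> 'a \<Rightarrow> ennreal"
  proof -
    let ?I = "\<lambda>n i. \<integral>\<^sup>+ x. kernel_iter K n (f i) x \<partial>\<gamma>"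
    have mono: "incseq (?I n)" for n
      unfolding incseq_def using f(2)
      by (auto intro!: nn_integral_mono kernel_iter_mono simp: space_\<gamma> incseq_def le_fun_def)
    have "(\<integral>\<^sup>+ x. kernel_iter K n (\<lambda>x. SUP i. f i x) x \<partial>\<gamma>) = (SUP i. ?I n i)" for n
    proof -
      have "(\<integral>\<^sup>+ x. kernel_iter K n (\<lambda>x. SUP i. f i x) x \<partial>\<gamma>) = (\<integral>\<^sup>+ x. (SUP i. kernel_iter K n (f i) x) \<partial>\<gamma>)"
        by (intro nn_integral_cong kernel_iter_SUP f) (simp add: space_\<gamma>)
      also have "\<dots> = (SUP i. ?I n i)"
      proof (rule nn_integral_monotone_convergence_SUP_AE)
        show "AE x in \<gamma>. kernel_iter K n (f i) x \<le> kernel_iter K n (f (Suc i)) x" for i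
          using incseq_kernel_iter[OF f(2), THEN incseq_SucD] by (intro AE_I2) (simp add: space_\<gamma>)
      qed (simp add: borel_measurable_\<gamma> f(1) kernel_iter_measurable)
      finally show ?thesis .
    qed
    moreover have "incseq (\<lambda>i. ennreal R ^ n * ?I n i)" for n
      using mono[of n] by (auto simp: incseq_def intro: mult_left_mono)
    ultimately show ?thesis
      by (simp add: \<Phi>_def SUP_mult_left_ennreal ennreal_suminf_SUP_eq)
  qed
qed

text \<open>From a finite point the kernel \<open>K\<close> almost surely never reaches the
  complement, and \<open>\<gamma>\<close> starts at finite points; hence every term of the series
  for \<open>\<nu>\<close> vanishes on the complement.\<close>

lemma AE_\<nu>_finite_pts: "AE x in \<nu>. x \<in> E\<^sub>R"
proof -
  let ?N = "space E - E\<^sub>R"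
  have zero: "kernel_iter K n (indicator ?N) x = 0" if "x \<in> E\<^sub>R" for n x
    using that
  proof (induction n arbitrary: x)
    case (Suc n)
    have "(\<integral>\<^sup>+ y. kernel_iter K n (indicator ?N) y \<partial>K x) = (\<integral>\<^sup>+ y. 0 \<partial>K x)"
      using AE_kernel_finite_pts[OF Suc.prems] Suc.IH
      by (intro nn_integral_cong_AE) (auto elim!: eventually_mono)
    then show ?case by simp
  qed simp
  have "(\<integral>\<^sup>+ x. kernel_iter K n (indicator ?N) x \<partial>\<gamma>) = (\<integral>\<^sup>+ x. 0 \<partial>\<gamma>)" for n
    using AE_\<gamma>_finite_pts zero by (intro nn_integral_cong_AE) (auto elim!: eventually_mono)
  then have "emeasure \<nu> ?N = 0"
    by (simp add: emeasure_\<nu> nu_fun_eq_\<Phi> \<Phi>_def)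
  then show ?thesis
    using sets_eq_imp_space_eq[OF sets_\<nu>] by (intro AE_I[of _ _ ?N]) (auto simp: sets_\<nu>)
qed

text \<open>The zeroth term of the series contributes 1 and the others \<open>f(R) = 1 / m\<close>;
  the factor \<open>m / (1 + m)\<close> normalizes the sum.\<close>

lemma emeasure_\<nu>_space: "emeasure \<nu> (space E) = 1"
proof -
  have "(\<Sum>n. ennreal R ^ n * d n) = (\<Sum>n. ennreal R ^ Suc n * d (Suc n)) + 1"
    using suminf_offset[of "\<lambda>n. ennreal R ^ n * d n" 1] by (simp add: d_0)
  also have "(\<Sum>n. ennreal R ^ Suc n * d (Suc n)) = ennreal (1 / m)"
    by (simp only: f_gen_root[symmetric] f_gen_eq)
  finally have "emeasure \<nu> (space E) = c * (ennreal (1 / m) + 1)"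
    by (simp add: emeasure_\<nu> nu_fun_eq_K_mass K_mass_space)
  also have "ennreal (1 / m) + 1 = ennreal (1 / m + 1)"
    using m_pos by simp
  also have "c * \<dots> = ennreal (m / (1 + m) * (1 / m + 1))"
    using m_pos by (intro ennreal_mult[symmetric]) auto
  also have "m / (1 + m) * (1 / m + 1) = 1"
    using m_pos by (simp add: divide_simps)
  finally show ?thesis by simp
qed

text \<open>Both \<open>S\<close> and \<open>\<nu>\<close> are series in \<open>K\<close>, so the
  integral is a double series whose terms depend only on the total power. Collecting equal powers
  gives the series of \<open>R * f'\<close>.\<close>

lemma nn_integral_u_\<nu>: "(\<integral>\<^sup>+ x. ennreal (u x) \<partial>\<nu>) = ennreal (m * R) * f'"
proof -
  let ?a = "\<lambda>N. ennreal R ^ Suc N * d (Suc N)"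
  have "\<Phi> S = (\<Sum>j. ennreal R ^ Suc j * \<Phi> (\<lambda>x. kernel_pow K (Suc j) x (space E)))"
  proof -
    have "\<Phi> S = (\<Sum>j. \<Phi> (\<lambda>x. ennreal R ^ Suc j * kernel_pow K (Suc j) x (space E)))"
      unfolding S_def[abs_def] using kernel_pow_measurable[OF sets.top]
      by (intro \<Phi>_suminf) (simp del: kernel_pow.simps)
    also have "\<dots> = (\<Sum>j. ennreal R ^ Suc j * \<Phi> (\<lambda>x. kernel_pow K (Suc j) x (space E)))"
      using kernel_pow_measurable[OF sets.top]
      by (simp del: kernel_pow.simps power_Suc add: nn_integral_\<nu>[symmetric] nn_integral_cmult
          measurable_cong_sets[OF sets_\<nu> refl])
    finally show ?thesis .
  qed
  also have "\<dots> = c * (\<Sum>j. \<Sum>n. ?a (j + n))"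
    by (simp add: \<Phi>_def kernel_pow_eq_iter kernel_iter_iter d_coeff_def power_add mult_ac add_ac
        flip: ennreal_suminf_cmult del: kernel_iter.simps)
  also have "\<dots> = c * (\<Sum>N. of_nat (Suc N) * ?a N)"
    by (simp only: suminf_suminf_shift[of ?a])
  also have "(\<Sum>N. of_nat (Suc N) * ?a N) = ennreal R * f'"
    unfolding f_gen_deriv_def by (simp add: mult_ac flip: ennreal_suminf_cmult)
  finally have "(\<integral>\<^sup>+ x. ennreal (u x) \<partial>\<nu>) = (c * ennreal (1 + m)) * (ennreal R * f')"
    by (simp only: nn_integral_u[OF sets_\<nu> AE_\<nu>_finite_pts] nn_integral_\<nu>[OF S_measurable] mult_ac)
  then show ?thesis
    using m_pos R_pos unfolding c_m by (simp add: mult.assoc ennreal_mult)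
qed

text \<open>Applying \<open>K\<close> raises each power of \<open>K\<close> by one, so
  \<open>R\<close> times the \<open>K\<close> part is the series of \<open>\<nu>\<close> without its
  zeroth term \<open>\<gamma>(A)\<close>. The jump part restores exactly this term because
  \<open>m * f(R) = 1\<close>.\<close>

lemma \<nu>_eigenmeasure:
  assumes A: "A \<in> sets E"
  shows "(\<integral>\<^sup>+ y. emeasure (M y) A \<partial>\<nu>) = ennreal (1 / R) * emeasure \<nu> A"
proof -
  have K1: "(\<integral>\<^sup>+ y. kernel_pow K 1 y B \<partial>\<nu>) = c * (\<Sum>n. ennreal R ^ n * K_mass B (Suc n))"
    if "B \<in> sets E" for B
    unfolding nn_integral_\<nu>[OF kernel_pow_measurable[OF that]]
    by (simp add: \<Phi>_def K_mass_def kernel_pow_eq_iter kernel_iter_iter del: kernel_iter.simps)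
  have shift: "ennreal R * (\<Sum>n. ennreal R ^ n * K_mass B (Suc n)) = (\<Sum>n. ennreal R ^ Suc n * K_mass B (Suc n))" for B
    by (simp add: mult.assoc flip: ennreal_suminf_cmult)
  have "(\<integral>\<^sup>+ y. emeasure (M y) A \<partial>\<nu>) =
      (\<integral>\<^sup>+ y. kernel_pow K 1 y A + kernel_pow K 1 y (space E) * (ennreal m * emeasure \<gamma> A) \<partial>\<nu>)"
    using A sets_eq_imp_space_eq[OF sets_\<nu>]
    by (intro nn_integral_cong) (simp add: emeasure_M_kernel sets_kernel sets_\<gamma> mult.assoc)
  also have "\<dots> = c * (\<Sum>n. ennreal R ^ n * K_mass A (Suc n)) +
      c * (\<Sum>n. ennreal R ^ n * K_mass (space E) (Suc n)) * (ennreal m * emeasure \<gamma> A)"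
    using kernel_pow_measurable A
    by (simp only: nn_integral_add nn_integral_multc measurable_cong_sets[OF sets_\<nu> refl] K1
        sets.top borel_measurable_times_ennreal borel_measurable_const)
  finally have "ennreal R * (\<integral>\<^sup>+ y. emeasure (M y) A \<partial>\<nu>) =
      c * (ennreal R * (\<Sum>n. ennreal R ^ n * K_mass A (Suc n))) +
      c * (ennreal R * (\<Sum>n. ennreal R ^ n * K_mass (space E) (Suc n))) * (ennreal m * emeasure \<gamma> A)"
    by (simp add: distrib_left mult_ac)
  also have "\<dots> = c * (\<Sum>n. ennreal R ^ Suc n * K_mass A (Suc n)) + c * (ennreal m * f_gen E K \<gamma> R) * emeasure \<gamma> A"
    unfolding shift unfolding K_mass_space f_gen_eq[symmetric] by (simp only: mult_ac)
  also have "\<dots> = c * ((\<Sum>n. ennreal R ^ Suc n * K_mass A (Suc n)) + K_mass A 0)"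
  proof -
    have "K_mass A 0 = emeasure \<gamma> A" using A by (simp add: K_mass_def sets_\<gamma>)
    then show ?thesis by (simp only: root distrib_left mult_1_right)
  qed
  also have "\<dots> = emeasure \<nu> A"
  proof -
    have "(\<Sum>n. ennreal R ^ n * K_mass A n) = (\<Sum>n. ennreal R ^ Suc n * K_mass A (Suc n)) + K_mass A 0"
      using suminf_offset[of "\<lambda>n. ennreal R ^ n * K_mass A n" 1] by simp
    then show ?thesis by (simp only: emeasure_\<nu>[OF A] nu_fun_eq_K_mass[OF A])
  qed
  finally have "ennreal (1 / R) * emeasure \<nu> A = (ennreal (1 / R) * ennreal R) * (\<integral>\<^sup>+ y. emeasure (M y) A \<partial>\<nu>)"
    by (simp add: mult.assoc)
  then show ?thesis using R_pos by (simp flip: ennreal_mult)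
qed

section \<open>The limit of \<open>R^n M^n(x, A)\<close>\<close>

definition q :: "nat \<Rightarrow> real" where
  "q j = m * R ^ Suc j * enn2real (d (Suc j))"

text \<open>The probability of a step longer than \<open>k\<close>, since \<open>q j\<close> belongs
  to a step of length \<open>j + 1\<close>.\<close>

definition t :: "nat \<Rightarrow> real" where
  "t k = 1 - (\<Sum>j<k. q j)"

lemma q_nonneg: "0 \<le> q j"
  using m_pos R_pos by (simp add: q_def)

lemma ennreal_q: "ennreal (q j) = ennreal m * (ennreal R ^ Suc j * d (Suc j))"
  using m_pos R_pos d_finite[of "Suc j"]
  by (simp add: q_def ennreal_mult ennreal_power mult.assoc less_top del: power_Suc)

lemma q_sums: "q sums 1"
proof -
  have "(\<Sum>j. ennreal (q j)) = 1"
    unfolding ennreal_q ennreal_suminf_cmult f_gen_eq[symmetric] by (rule root)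
  then have "(\<lambda>j. ennreal (q j)) sums ennreal 1"
    using summable_sums[of "\<lambda>j. ennreal (q j)"] by simp
  then show ?thesis by (subst (asm) sums_ennreal) (simp_all add: q_nonneg)
qed

lemma q_0_pos: "0 < q 0"
proof (rule ccontr)
  assume "\<not> 0 < q 0"
  then have "d 1 = 0"
    using R_pos m_pos d_finite[of 1] by (auto simp: q_def zero_less_mult_iff enn2real_eq_0_iff dest!: not_less[THEN iffD1] enn2real_nonneg[THEN order_antisym])
  then have "d (Suc j) = 0" for j
    using d_antimono[of 1 "Suc j"] by simp
  then have "q = (\<lambda>_. 0)" by (simp add: q_def fun_eq_iff)
  then show False using q_sums by (simp add: sums_iff)
qed

lemma t_nonneg: "0 \<le> t k"
  using sum_le_suminf[OF sums_summable[OF q_sums], of "{..<k}"] q_nonneg sums_unique[OF q_sums]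
  by (auto simp: t_def)

text \<open>The mean of a distribution is the sum of its tails; the weight \<open>Suc N\<close> is
  the step length belonging to \<open>q N\<close>.\<close>

lemma suminf_t: "(\<Sum>k. ennreal (t k)) = ennreal (m * R) * f'"
proof -
  have "(\<Sum>j. ennreal (q (k + j))) = ennreal (t k)" for k
  proof -
    have "(\<lambda>j. q (k + j)) sums t k"
      using sums_split_initial_segment[OF q_sums, of k] by (simp add: t_def add.commute)
    then have "(\<lambda>j. ennreal (q (k + j))) sums ennreal (t k)"
      by (subst sums_ennreal) (simp_all add: q_nonneg t_nonneg)
    then show ?thesis by (rule sums_unique[symmetric])
  qed
  then have "(\<Sum>k. ennreal (t k)) = (\<Sum>N. of_nat (Suc N) * ennreal (q N))"
    using suminf_suminf_shift[of "\<lambda>j. ennreal (q j)"] by simp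
  also have "\<dots> = (\<Sum>N. ennreal (m * R) * (of_nat (Suc N) * d (Suc N) * ennreal R ^ N))"
    using m_pos R_pos by (simp only: ennreal_q) (simp add: ennreal_mult mult_ac)
  finally show ?thesis
    by (simp only: f_gen_deriv_def ennreal_suminf_cmult)
qed

lemma summable_t_iff: "summable t \<longleftrightarrow> f' < \<infinity>"
proof
  assume "summable t"
  then have "(\<Sum>k. ennreal (t k)) \<noteq> top"
    by (intro ennreal_suminf_neq_top t_nonneg)
  then show "f' < \<infinity>"
    using m_pos R_pos unfolding suminf_t
    by (cases "f' = top") (auto simp: ennreal_mult_eq_top_iff less_top[symmetric])
next
  assume "f' < \<infinity>"
  then have "(\<Sum>k. ennreal (t k)) \<noteq> top"
    unfolding suminf_t by (auto simp: ennreal_mult_eq_top_iff)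
  then show "summable t"
    using t_nonneg by (intro summable_suminf_not_top)
qed

lemma M_pow_tendsto:
  assumes x: "x \<in> E\<^sub>R" and A: "A \<in> sets E"
  shows "(\<lambda>n. ennreal R ^ n * kernel_pow M n x A) \<longlonglongrightarrow>
    (if f' < \<infinity> then ennreal (u x) * emeasure \<nu> A / (ennreal (m * R) * f') else 0)"
proof -
  note xE = finite_pts_space[OF x]
  \<comment> \<open>Real versions of the scaled quantities, all of which are finite.
    \<open>\<alpha>\<close> and \<open>\<kappa>\<close> start at the first power, as
    \<open>S\<close> does.\<close>
  define G where "G n = R ^ n * enn2real (M_mass A n)" for n
  define b where "b n = R ^ n * enn2real (K_mass A n)" for n
  define \<alpha> where "\<alpha> n = R ^ Suc n * enn2real (kernel_pow K (Suc n) x (space E))" for n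
  define \<kappa> where "\<kappa> n = R ^ Suc n * enn2real (kernel_pow K (Suc n) x A)" for n
  define l where "l = (if summable t then suminf b / suminf t else 0)"

  have G_nonneg: "0 \<le> G n" and b_nonneg: "0 \<le> b n" and \<alpha>_nonneg: "0 \<le> \<alpha> n" and \<kappa>_nonneg: "0 \<le> \<kappa> n" for n
    using R_pos by (auto simp: G_def b_def \<alpha>_def \<kappa>_def)
  have K_finite: "kernel_pow K n x B < top" for n B
    using kernel_pow_le_1[OF xE, of n B] by (rule le_less_trans) simp
  have ennreal_G: "ennreal (G n) = ennreal R ^ n * M_mass A n" for n
    using R_pos M_mass_finite[OF A, of n] by (simp add: G_def ennreal_mult ennreal_power less_top)
  have ennreal_b: "ennreal (b n) = ennreal R ^ n * K_mass A n" for n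
    using R_pos K_mass_finite[of A n] by (simp add: b_def ennreal_mult ennreal_power less_top)
  have ennreal_\<alpha>: "ennreal (\<alpha> n) = ennreal R ^ Suc n * kernel_pow K (Suc n) x (space E)" for n
    using R_pos K_finite[of "Suc n"] by (simp add: \<alpha>_def ennreal_mult ennreal_power del: power_Suc kernel_pow.simps)
  have ennreal_\<kappa>: "ennreal (\<kappa> n) = ennreal R ^ Suc n * kernel_pow K (Suc n) x A" for n
    using R_pos K_finite[of "Suc n"] by (simp add: \<kappa>_def ennreal_mult ennreal_power del: power_Suc kernel_pow.simps)

  have emeasure_\<nu>_b: "emeasure \<nu> A = c * (\<Sum>n. ennreal (b n))"
    by (simp add: emeasure_\<nu>[OF A] nu_fun_eq_K_mass[OF A] ennreal_b)
  \<comment> \<open>Up to the positive factor \<open>c\<close> the sum is \<open>\<nu>(A)\<close>,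
    which is at most 1.\<close>
  have b_finite: "(\<Sum>n. ennreal (b n)) \<noteq> top"
  proof
    assume "(\<Sum>n. ennreal (b n)) = top"
    then have "emeasure \<nu> A = top"
      using m_pos by (simp add: emeasure_\<nu>_b ennreal_mult_eq_top_iff)
    moreover have "emeasure \<nu> A \<le> 1"
      using A sets.sets_into_space[OF A] by (subst emeasure_\<nu>_space[symmetric]) (intro emeasure_mono, auto simp: sets_\<nu>)
    ultimately show False by (simp add: top_unique)
  qed
  then have b_summable: "summable b"
    using b_nonneg by (intro summable_suminf_not_top)
  have \<nu>_A: "emeasure \<nu> A = ennreal (m / (1 + m) * suminf b)"
    using m_pos b_nonneg b_summable
    by (simp only: emeasure_\<nu>_b suminf_ennreal2) (intro ennreal_mult[symmetric], auto intro: suminf_nonneg)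

  have S_\<alpha>: "(\<Sum>n. ennreal (\<alpha> n)) = S x"
    by (simp only: ennreal_\<alpha> S_def)
  then have \<alpha>_summable: "summable \<alpha>"
    using x \<alpha>_nonneg by (intro summable_suminf_not_top) (auto simp: finite_pts_eq)
  have S_x: "enn2real (S x) = suminf \<alpha>"
    using S_\<alpha> suminf_ennreal2[OF \<alpha>_nonneg \<alpha>_summable] \<alpha>_summable \<alpha>_nonneg
    by (metis enn2real_ennreal suminf_nonneg)

  have G_Suc: "G (Suc n) = b (Suc n) + (\<Sum>j\<le>n. q j * G (n - j))" for n
  proof -
    have "ennreal (G (Suc n)) = ennreal (b (Suc n)) +
        (\<Sum>j\<le>n. ennreal R ^ Suc n * (ennreal m * d (Suc j) * M_mass A (n - j)))"
      by (simp add: ennreal_G ennreal_b M_mass_renewal[OF A] distrib_left sum_distrib_left del: power_Suc)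
    also have "(\<Sum>j\<le>n. ennreal R ^ Suc n * (ennreal m * d (Suc j) * M_mass A (n - j))) =
        (\<Sum>j\<le>n. ennreal (q j * G (n - j)))"
    proof (intro sum.cong refl)
      fix j assume "j \<in> {..n}"
      \<comment> \<open>Of the \<open>n + 1\<close> factors \<open>R\<close>, the first
        \<open>j + 1\<close> belong to \<open>q j\<close> and the remaining \<open>n - j\<close> to
        \<open>G (n - j)\<close>.\<close>
      then have R_split: "ennreal R ^ Suc n = ennreal R ^ Suc j * ennreal R ^ (n - j)"
        by (simp flip: power_add del: power_Suc)
      show "ennreal R ^ Suc n * (ennreal m * d (Suc j) * M_mass A (n - j)) = ennreal (q j * G (n - j))"
        unfolding ennreal_mult[OF q_nonneg G_nonneg] ennreal_q ennreal_G R_split by (simp only: mult_ac)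
    qed
    also have "\<dots> = ennreal (\<Sum>j\<le>n. q j * G (n - j))"
      by (intro sum_ennreal mult_nonneg_nonneg q_nonneg G_nonneg)
    finally have "ennreal (G (Suc n)) = ennreal (b (Suc n) + (\<Sum>j\<le>n. q j * G (n - j)))"
      using b_nonneg by (simp add: ennreal_plus[symmetric] sum_nonneg q_nonneg G_nonneg del: ennreal_plus)
    then show ?thesis
      by (subst (asm) ennreal_inj) (auto intro!: add_nonneg_nonneg sum_nonneg mult_nonneg_nonneg q_nonneg G_nonneg b_nonneg)
  qed
  have "G 0 = b 0" by (simp add: G_def b_def M_mass_def K_mass_def)
  from renewal_equation_tendsto[OF q_nonneg q_sums q_0_pos _ this G_Suc]
  have G_lim: "G \<longlonglongrightarrow> l"
    using b_summable b_nonneg unfolding l_def t_def[abs_def] by simp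

  have conv: "ennreal R ^ Suc n * kernel_pow M (Suc n) x A =
      ennreal (\<kappa> n + m * (\<Sum>j\<le>n. \<alpha> j * G (n - j)))" for n
  proof -
    have "ennreal R ^ Suc n * kernel_pow M (Suc n) x A = ennreal (\<kappa> n) +
        (\<Sum>j\<le>n. ennreal R ^ Suc n * (ennreal m * kernel_pow K (Suc j) x (space E) * M_mass A (n - j)))"
      unfolding M_pow_decomposition[OF A xE]
      by (simp only: ennreal_\<kappa> distrib_left sum_distrib_left)
    also have "(\<Sum>j\<le>n. ennreal R ^ Suc n * (ennreal m * kernel_pow K (Suc j) x (space E) * M_mass A (n - j))) =
        (\<Sum>j\<le>n. ennreal (m * (\<alpha> j * G (n - j))))"
    proof (intro sum.cong refl)
      fix j assume "j \<in> {..n}"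
      then have R_split: "ennreal R ^ Suc n = ennreal R ^ Suc j * ennreal R ^ (n - j)"
        by (simp flip: power_add del: power_Suc)
      show "ennreal R ^ Suc n * (ennreal m * kernel_pow K (Suc j) x (space E) * M_mass A (n - j)) =
          ennreal (m * (\<alpha> j * G (n - j)))"
        unfolding ennreal_mult[OF less_imp_le[OF m_pos] mult_nonneg_nonneg[OF \<alpha>_nonneg G_nonneg]]
          ennreal_mult[OF \<alpha>_nonneg G_nonneg] ennreal_\<alpha> ennreal_G R_split by (simp only: mult_ac)
    qed
    also have "\<dots> = ennreal (\<Sum>j\<le>n. m * (\<alpha> j * G (n - j)))"
      using m_pos by (intro sum_ennreal mult_nonneg_nonneg \<alpha>_nonneg G_nonneg) auto
    finally show ?thesis
      using m_pos by (simp add: ennreal_plus[symmetric] sum_distrib_left \<kappa>_nonneg sum_nonneg \<alpha>_nonneg G_nonneg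
          del: ennreal_plus kernel_pow.simps power_Suc)
  qed

  \<comment> \<open>Paths without a jump according to \<open>\<gamma>\<close> are negligible:
    \<open>\<kappa>\<close> is dominated by the terms of the convergent series for
    \<open>S x\<close>.\<close>
  have "\<kappa> \<longlonglongrightarrow> 0"
  proof (rule tendsto_sandwich[OF _ _ tendsto_const summable_LIMSEQ_zero[OF \<alpha>_summable]])
    have "kernel_pow K (Suc n) x A \<le> kernel_pow K (Suc n) x (space E)" for n
      using sets.sets_into_space[OF A] xE by (rule kernel_pow_mono)
    then show "\<forall>\<^sub>F n in sequentially. \<kappa> n \<le> \<alpha> n"
      unfolding \<kappa>_def \<alpha>_def using R_pos K_finite
      by (intro always_eventually allI mult_left_mono enn2real_mono) (auto simp del: kernel_pow.simps)
  qed (simp add: \<kappa>_nonneg)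
  then have "(\<lambda>n. \<kappa> n + m * (\<Sum>j\<le>n. \<alpha> j * G (n - j))) \<longlonglongrightarrow> 0 + m * (suminf \<alpha> * l)"
    using \<alpha>_summable \<alpha>_nonneg by (intro tendsto_intros tendsto_convolution G_lim) auto
  then have "(\<lambda>n. ennreal R ^ Suc n * kernel_pow M (Suc n) x A) \<longlonglongrightarrow> ennreal (m * (suminf \<alpha> * l))"
    unfolding conv by (intro tendsto_ennrealI) simp
  then have lim: "(\<lambda>n. ennreal R ^ n * kernel_pow M n x A) \<longlonglongrightarrow> ennreal (m * (suminf \<alpha> * l))"
    by (rule filterlim_sequentially_Suc[THEN iffD1])
  show ?thesis
  proof (cases "f' < \<infinity>")
    case True
    then have t: "summable t" by (simp add: summable_t_iff)
    \<comment> \<open>As \<open>t 0 = 1\<close>, the mean is positive, so the division in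
      \<open>ennreal\<close> is a real division.\<close>
    have "t 0 \<le> suminf t"
      using sum_le_suminf[OF t, of "{0}"] t_nonneg by simp
    then have T_pos: "0 < suminf t" by (simp add: t_def)
    have "ennreal (m * R) * f' = ennreal (suminf t)"
      using suminf_t suminf_ennreal2[OF t_nonneg t] by simp
    then have "ennreal (u x) * emeasure \<nu> A / (ennreal (m * R) * f') =
        ennreal ((1 + m) * suminf \<alpha> * (m / (1 + m) * suminf b) / suminf t)"
      using m_pos T_pos suminf_nonneg[OF b_summable b_nonneg] suminf_nonneg[OF \<alpha>_summable \<alpha>_nonneg]
      by (simp add: u_eq_S[OF x] S_x \<nu>_A divide_ennreal flip: ennreal_mult)
    \<comment> \<open>The factor \<open>1 + m\<close> of \<open>u\<close> cancels the denominator in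
      the normalization of \<open>\<nu>\<close>.\<close>
    also have "(1 + m) * suminf \<alpha> * (m / (1 + m) * suminf b) / suminf t = m * (suminf \<alpha> * l)"
      using m_pos by (simp add: l_def t)
    finally show ?thesis using lim True by simp
  next
    case False
    then show ?thesis using lim by (simp add: l_def summable_t_iff)
  qed
qed

end

theorem theorem4:
  fixes E :: "'a measure" and K :: "'a \<Rightarrow> 'a measure" and \<gamma> :: "'a measure" and m :: real
  assumes "K \<in> measurable E (subprob_algebra E)"
    and "prob_space \<gamma>" and "sets \<gamma> = sets E"
    and "0 < m"
    and "f_at_R_star E K \<gamma> \<ge> ennreal (1 / m)"
  shows "(\<exists>!R::real. 0 < R \<and> ennreal m * f_gen E K \<gamma> R = 1) \<and>
    (\<forall>R::real. 0 < R \<and> ennreal m * f_gen E K \<gamma> R = 1 \<longrightarrow>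
      (let M = M_kernel E K \<gamma> m; u = u_fun E K m R; \<nu> = nu_measure E K \<gamma> m R;
           f' = f_gen_deriv E K \<gamma> R; \<rho> = 1 / R
       in
         u \<in> borel_measurable E \<and> (\<forall>x\<in>space E. 0 \<le> u x) \<and>
         sets \<nu> = sets E \<and> (\<forall>A\<in>sets E. emeasure \<nu> A = nu_fun K \<gamma> m R A) \<and>
         (\<integral>\<^sup>+ x. ennreal (u x) \<partial>\<gamma>) = ennreal ((1 + m) / m) \<and>
         emeasure \<nu> (space E) = 1 \<and>
         (\<integral>\<^sup>+ x. ennreal (u x) \<partial>\<nu>) = ennreal (m * R) * f' \<and>
         (\<forall>x\<in>finite_pts E K R. (\<integral>\<^sup>+ y. ennreal (u y) \<partial>M x) = ennreal (\<rho> * u x)) \<and>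
         (\<forall>A\<in>sets E. (\<integral>\<^sup>+ y. emeasure (M y) A \<partial>\<nu>) = ennreal \<rho> * emeasure \<nu> A) \<and>
         (\<forall>x\<in>finite_pts E K R. \<forall>A\<in>sets E.
            (f' < \<infinity> \<longrightarrow>
              (\<lambda>n. ennreal R ^ n * kernel_pow M n x A)
                \<longlonglongrightarrow> ennreal (u x) * emeasure \<nu> A / (ennreal (m * R) * f')) \<and>
            (f' = \<infinity> \<longrightarrow> (\<lambda>n. ennreal R ^ n * kernel_pow M n x A) \<longlonglongrightarrow> 0))))"
proof -
  interpret rank_one_perturbation E K \<gamma> m
    by (intro rank_one_perturbation.intro subprob_kernel.intro rank_one_perturbation_axioms.intro assms)
  show ?thesis
  proof (intro conjI allI impI, goal_cases)
    case 1
    show ?case using assms(5) by (rule ex1_root)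
  next
    case (2 R)
    then interpret positive_root E K \<gamma> m R
      by (intro positive_root.intro positive_root_axioms.intro rank_one_perturbation_axioms) auto
    \<comment> \<open>The two limit statements are the two branches of the conditional in
      \<open>M_pow_tendsto\<close>.\<close>
    show ?case
      unfolding Let_def
      by (intro conjI ballI impI u_measurable u_nonneg sets_\<nu> emeasure_\<nu> nn_integral_u_\<gamma> emeasure_\<nu>_space
          nn_integral_u_\<nu> u_eigenfunction \<nu>_eigenmeasure) (use M_pow_tendsto in force)+
  qed
qed

end
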